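(* Let $\mathbb X$ and $\mathbb Y$ be two non-constant flow spaces each belonging to $\Sigma$ or to $\mathrm T$. Then $\mathbb X$ and $\mathbb Y$ are flow equivalent if and only if they have admissible expansions whose symbol sequences are tail equivalent.
   Context: Let $F_2$ be free on $\{a,b\}$, with positive endomorphisms $\sigma\colon a\mapsto aabaabab,\ b\mapsto aabab$; $\tau\colon a\mapsto aabaabab,\ b\mapsto abaab$; $\rho\colon a\mapsto ba,\ b\mapsto bba$. Let $W_2$ be an oriented wedge of two circles labelled $a,b$, and for $\theta\in\{\sigma,\tau,\rho\}$ let $f_\theta\colon W_2\to W_2$ be a positive map (continuous surjection, wedge point to wedge point, orientation preserving on each circle, locally injective away from the wedge point) whose image of circle $x$ traverses in order the circles spelled by $\theta(x)$. Flow space: compact metrizable space of dimension one with continuous $\mathbb R$-action without fixed points; flow equivalence: homeomorphism mapping orbits to orbits preserving flow orientation. Expansion of $\mathbb X$ about a point: oriented wedges $X_i$, positive maps $f_i\colon X_{i+1}\to X_i$, projections $p_i\colon\mathbb X\to X_i$ (continuous surjections, locally injective and orientation preserving along orbits, sending the point to the wedge point) with $p_n=f_n\circ\cdots\circ f_{m-1}\circ p_m$ and $x\mapsto(p_i(x))_i$ a homeomorphism onto $\varprojlim(X_i,f_i)$. $\Sigma$: flow spaces admitting an expansion with all $X_i=W_2$ and all $f_i\in\{f_\sigma,f_\rho\}$; $\mathrm T$: same with $f_i\in\{f_\tau,f_\rho\}$. Such expansions are admissible and identified with their infinite symbol sequences. Sequences $(s_i)$, $(t_i)$ are tail equivalent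 if there exist $k,l$ with $s_{k+j}=t_{l+j}$ for all $j\ge0$. A space in $\Sigma$ or $\mathrm T$ is non-constant if it has an admissible expansion whose symbol sequence is not tail equivalent to a constant sequence. *)

theory Defs
  imports "HOL-Analysis.Analysis"
begin

datatype gen = GA | GB

text \<open>Oriented parametrisation (period 1) of the two circles of W_2, realised in the
complex plane as two circles of radius 1 tangent at the wedge point 0.\<close>
definition gam :: "gen \<Rightarrow> real \<Rightarrow> complex" where
  "gam c s = (case c of GA \<Rightarrow> -1 + cis (2 * pi * s) | GB \<Rightarrow> 1 - cis (2 * pi * s))"

definition W2 :: "complex set" where
  "W2 = range (gam GA) \<union> range (gam GB)"

definition wedge_pt :: complex where "wedge_pt = 0"

definition sigma_sub :: "gen \<Rightarrow> gen list" where
  "sigma_sub c = (case c of GA \<Rightarrow> [GA,GA,GB,GA,GA,GB,GA,GB] | GB \<Rightarrow> [GA,GA,GB,GA,GB])"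

definition tau_sub :: "gen \<Rightarrow> gen list" where
  "tau_sub c = (case c of GA \<Rightarrow> [GA,GA,GB,GA,GA,GB,GA,GB] | GB \<Rightarrow> [GA,GB,GA,GA,GB])"

definition rho_sub :: "gen \<Rightarrow> gen list" where
  "rho_sub c = (case c of GA \<Rightarrow> [GB,GA] | GB \<Rightarrow> [GB,GB,GA])"

definition realizes_word :: "(complex \<Rightarrow> complex) \<Rightarrow> gen \<Rightarrow> gen list \<Rightarrow> bool" where
  "realizes_word f c w \<longleftrightarrow>
     (\<exists>t :: nat \<Rightarrow> real. t 0 = 0 \<and> t (length w) = 1 \<and>
        (\<forall>k < length w. t k < t (Suc k) \<and>
           (\<exists>h. continuous_on {t k .. t (Suc k)} h \<and> strict_mono_on {t k .. t (Suc k)} h \<and>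
                h (t k) = 0 \<and> h (t (Suc k)) = 1 \<and>
                (\<forall>s \<in> {t k .. t (Suc k)}. f (gam c s) = gam (w ! k) (h s)))))"

definition positive_map_for :: "(gen \<Rightarrow> gen list) \<Rightarrow> (complex \<Rightarrow> complex) \<Rightarrow> bool" where
  "positive_map_for \<theta> f \<longleftrightarrow>
     continuous_on W2 f \<and> f ` W2 \<subseteq> W2 \<and> f wedge_pt = wedge_pt \<and>
     (\<forall>c. realizes_word f c (\<theta> c))"

text \<open>A path in W_2 that is locally injective and orientation preserving: on a small
one-sided neighbourhood on either side of every time it runs positively along one circle.\<close>
definition positive_path :: "(real \<Rightarrow> complex) \<Rightarrow> bool" where
  "positive_path g \<longleftrightarrow>
     (\<forall>t0. \<exists>\<epsilon>>0.
        (\<exists>c \<alpha>. continuous_on {t0 .. t0 + \<epsilon>} \<alpha> \<and> strict_mono_on {t0 .. t0 + \<epsilon>} \<alpha> \<and>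
               \<alpha> (t0 + \<epsilon>) - \<alpha> t0 < 1 \<and> (\<forall>t \<in> {t0 .. t0 + \<epsilon>}. g t = gam c (\<alpha> t))) \<and>
        (\<exists>c \<alpha>. continuous_on {t0 - \<epsilon> .. t0} \<alpha> \<and> strict_mono_on {t0 - \<epsilon> .. t0} \<alpha> \<and>
               \<alpha> t0 - \<alpha> (t0 - \<epsilon>) < 1 \<and> (\<forall>t \<in> {t0 - \<epsilon> .. t0}. g t = gam c (\<alpha> t))))"

definition cover_dim_le :: "'a topology \<Rightarrow> nat \<Rightarrow> bool" where
  "cover_dim_le X n \<longleftrightarrow>
     (\<forall>\<U>. finite \<U> \<and> (\<forall>U\<in>\<U>. openin X U) \<and> topspace X \<subseteq> \<Union>\<U> \<longrightarrow>
        (\<exists>\<V>. finite \<V> \<and> (\<forall>V\<in>\<V>. openin X V) \<and> topspace X \<subseteq> \<Union>\<V> \<and>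
             (\<forall>V\<in>\<V>. \<exists>U\<in>\<U>. V \<subseteq> U) \<and>
             (\<forall>x\<in>topspace X. card {V\<in>\<V>. x \<in> V} \<le> n + 1)))"

definition dimension_one :: "'a topology \<Rightarrow> bool" where
  "dimension_one X \<longleftrightarrow> cover_dim_le X 1 \<and> \<not> cover_dim_le X 0"

definition is_flow :: "'a topology \<Rightarrow> (real \<Rightarrow> 'a \<Rightarrow> 'a) \<Rightarrow> bool" where
  "is_flow X \<phi> \<longleftrightarrow>
     continuous_map (prod_topology euclideanreal X) X (\<lambda>(t, x). \<phi> t x) \<and>
     (\<forall>x\<in>topspace X. \<phi> 0 x = x) \<and>
     (\<forall>s t. \<forall>x\<in>topspace X. \<phi> (s + t) x = \<phi> s (\<phi> t x))"

definition flow_space :: "'a topology \<Rightarrow> (real \<Rightarrow> 'a \<Rightarrow> 'a) \<Rightarrow> bool" where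
  "flow_space X \<phi> \<longleftrightarrow>
     compact_space X \<and> metrizable_space X \<and> dimension_one X \<and> is_flow X \<phi> \<and>
     (\<forall>x\<in>topspace X. \<exists>t. \<phi> t x \<noteq> x)"

definition orbit :: "(real \<Rightarrow> 'a \<Rightarrow> 'a) \<Rightarrow> 'a \<Rightarrow> 'a set" where
  "orbit \<phi> x = range (\<lambda>t. \<phi> t x)"

definition flow_equivalent ::
  "'a topology \<Rightarrow> (real \<Rightarrow> 'a \<Rightarrow> 'a) \<Rightarrow> 'b topology \<Rightarrow> (real \<Rightarrow> 'b \<Rightarrow> 'b) \<Rightarrow> bool" where
  "flow_equivalent X \<phi> Y \<psi> \<longleftrightarrow>
     (\<exists>h. homeomorphic_map X Y h \<and>
          (\<forall>x\<in>topspace X. h ` orbit \<phi> x = orbit \<psi> (h x) \<and>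
             (\<exists>\<tau> :: real \<Rightarrow> real. strict_mono \<tau> \<and> \<tau> 0 = 0 \<and>
                 (\<forall>t. h (\<phi> t x) = \<psi> (\<tau> t) (h x)))))"

definition inv_limit :: "(nat \<Rightarrow> complex \<Rightarrow> complex) \<Rightarrow> (nat \<Rightarrow> complex) set" where
  "inv_limit F = {z. (\<forall>i. z i \<in> W2) \<and> (\<forall>i. z i = F i (z (Suc i)))}"

definition inv_limit_top :: "(nat \<Rightarrow> complex \<Rightarrow> complex) \<Rightarrow> (nat \<Rightarrow> complex) topology" where
  "inv_limit_top F = subtopology (product_topology (\<lambda>_. top_of_set W2) UNIV) (inv_limit F)"

definition expansion ::
  "'a topology \<Rightarrow> (real \<Rightarrow> 'a \<Rightarrow> 'a) \<Rightarrow> 'a \<Rightarrow> (nat \<Rightarrow> complex \<Rightarrow> complex) \<Rightarrow> (nat \<Rightarrow> 'a \<Rightarrow> complex) \<Rightarrow> bool" where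
  "expansion X \<phi> x0 F p \<longleftrightarrow>
     x0 \<in> topspace X \<and>
     (\<forall>i. continuous_map X (top_of_set W2) (p i) \<and> p i ` topspace X = W2 \<and>
          p i x0 = wedge_pt \<and>
          (\<forall>x\<in>topspace X. positive_path (\<lambda>t. p i (\<phi> t x)))) \<and>
     (\<forall>i. \<forall>x\<in>topspace X. p i x = F i (p (Suc i) x)) \<and>
     homeomorphic_map X (inv_limit_top F) (\<lambda>x i. p i x)"

datatype sym = Sig | Tau | Rho

definition bond :: "(complex \<Rightarrow> complex) \<Rightarrow> (complex \<Rightarrow> complex) \<Rightarrow> (complex \<Rightarrow> complex) \<Rightarrow> sym \<Rightarrow> complex \<Rightarrow> complex" where
  "bond fs ft fr a = (case a of Sig \<Rightarrow> fs | Tau \<Rightarrow> ft | Rho \<Rightarrow> fr)"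

definition has_expansion_seq where
  "has_expansion_seq X \<phi> fs ft fr s \<longleftrightarrow> (\<exists>x0 p. expansion X \<phi> x0 (\<lambda>i. bond fs ft fr (s i)) p)"

definition in_Sigma where
  "in_Sigma X \<phi> fs ft fr \<longleftrightarrow> flow_space X \<phi> \<and>
     (\<exists>s. (\<forall>i. s i \<in> {Sig, Rho}) \<and> has_expansion_seq X \<phi> fs ft fr s)"

definition in_T where
  "in_T X \<phi> fs ft fr \<longleftrightarrow> flow_space X \<phi> \<and>
     (\<exists>s. (\<forall>i. s i \<in> {Tau, Rho}) \<and> has_expansion_seq X \<phi> fs ft fr s)"

definition admissible_seq where
  "admissible_seq X \<phi> fs ft fr s \<longleftrightarrow>
     ((\<forall>i. s i \<in> {Sig, Rho}) \<or> (\<forall>i. s i \<in> {Tau, Rho})) \<and> has_expansion_seq X \<phi> fs ft fr s"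

definition tail_equiv :: "(nat \<Rightarrow> 'c) \<Rightarrow> (nat \<Rightarrow> 'c) \<Rightarrow> bool" where
  "tail_equiv s t \<longleftrightarrow> (\<exists>k l. \<forall>j. s (k + j) = t (l + j))"

definition non_constant where
  "non_constant X \<phi> fs ft fr \<longleftrightarrow>
     (\<exists>s. admissible_seq X \<phi> fs ft fr s \<and> \<not> (\<exists>c. tail_equiv s (\<lambda>_. c)))"

end

(* A positive path in the wedge becomes, after folding the two circles onto one, a path in a circle
   that lifts to a strictly increasing function on the line; compactness and the absence of
   constant paths in limit points make this lift unbounded.

   Suppose both spaces have expansions with the same bonding maps, which holds after dropping
   initial terms of tail equivalent sequences. The projections then identify both spaces with the
   same inverse limit, hence give a homeomorphism h. Parametrise the orbits of x and h x by the lifts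
   of their zeroth projections. The two threads of projections agree at x. Two paths that leave a
   point along the same circle keep agreeing until they may switch circles, i.e. until the
   zeroth projection meets the wedge point. At a wedge point the paths on level m + 1 could depart
   along different circles, but the words assigned to a and b by each substitution start with the
   same letter, so their images on level m depart along the same circle. Hence the threads agree
   forever, and h maps orbits to orbits. Backward time follows from forward time by starting further back.

   Conversely a flow equivalence carries any expansion of one space to the other, so both have
   admissible expansions with equal symbol sequences. *)
theory Submission
  imports Defs
begin


section \<open>Winding coordinates on the wedge of two circles\<close>

text \<open>Folds both circles of the wedge onto the unit circle. The two branches agree at the wedge point
  only, so this is continuous on \<open>W2\<close> but not on the plane.\<close>

definition wind :: "complex \<Rightarrow> complex" where
  "wind z = (if Re z \<le> 0 then 1 + z else 1 - z)"

lemma gam_in_W2: "gam c s \<in> W2"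
  by (cases c) (auto simp: W2_def)

lemma W2_cases:
  assumes "z \<in> W2" obtains c s where "z = gam c s"
  using assms by (auto simp: W2_def)

lemma wind_gam: "wind (gam c s) = cis (2 * pi * s)"
proof (cases c)
  case GA
  then show ?thesis by (simp add: wind_def gam_def)
next
  case GB
  \<comment> \<open>A point of the circle \<open>GB\<close> reaches the branch meant for
    \<open>GA\<close> only at the wedge point, where both branches give 1.\<close>
  have "cis x = 1" if "1 \<le> cos x" for x
  proof -
    have "cos x = 1" using that cos_le_one[of x] by linarith
    then show ?thesis using cos_one_sin_zero[of x] by (simp add: complex_eq_iff)
  qed
  then show ?thesis using GB by (auto simp: wind_def gam_def)
qed

lemma continuous_on_wind: "continuous_on W2 wind"
  unfolding wind_def
proof (rule continuous_on_cases_le)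
  fix z assume "z \<in> W2" "Re z = 0"
  then obtain c s where z: "z = gam c s" using W2_cases by blast
  then have "cos (2 * pi * s) = 1" using \<open>Re z = 0\<close> by (cases c) (auto simp: gam_def)
  then have "z = 0" using z cos_one_sin_zero[of "2 * pi * s"]
    by (cases c) (auto simp: gam_def complex_eq_iff)
  then show "1 + z = 1 - z" by simp
qed (intro continuous_intros)+

lemma cis_eq_iff_Ints: "cis (2 * pi * a) = cis (2 * pi * b) \<longleftrightarrow> a - b \<in> \<int>"
proof
  assume "cis (2 * pi * a) = cis (2 * pi * b)"
  then have "sin (2 * pi * a) = sin (2 * pi * b) \<and> cos (2 * pi * a) = cos (2 * pi * b)"
    by (simp add: complex_eq_iff)
  then obtain n :: int where "2 * pi * a = 2 * pi * b + 2 * pi * n"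
    by (auto simp: sin_cos_eq_iff)
  then have "2 * pi * (a - b) = 2 * pi * of_int n" by (simp add: algebra_simps)
  then have "a - b = of_int n" by simp
  then show "a - b \<in> \<int>" by simp
next
  assume "a - b \<in> \<int>"
  then obtain n :: int where "a - b = of_int n" by (auto elim: Ints_cases)
  then have "2 * pi * a = 2 * pi * b + 2 * pi * n"
    by (metis add.commute diff_add_cancel distrib_left)
  then show "cis (2 * pi * a) = cis (2 * pi * b)"
    by (metis (no_types) cis.sel complex_eq_iff sin_cos_eq_iff)
qed

lemma gam_periodic: "a - b \<in> \<int> \<Longrightarrow> gam c a = gam c b"
  using cis_eq_iff_Ints[of a b] by (cases c) (auto simp: gam_def)

lemma gam_eq_wedge_iff: "gam c s = wedge_pt \<longleftrightarrow> s \<in> \<int>"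
  using cis_eq_iff_Ints[of s 0] by (cases c) (auto simp: gam_def wedge_pt_def algebra_simps)

lemma gam_eq_imp_Ints: "gam c a = gam d b \<Longrightarrow> a - b \<in> \<int>"
  by (metis cis_eq_iff_Ints wind_gam)

text \<open>The circles lie in the half planes of nonpositive and of nonnegative real part, so a
  common point has real part 0 on both. Each circle meets the imaginary axis at the wedge point
  only.\<close>

lemma gam_eq_imp_same_circle:
  assumes "gam c a = gam d b" "gam c a \<noteq> wedge_pt"
  shows "c = d"
proof -
  have "cis (2 * pi * a) = 1" if "gam GA a = gam GB b'" for a b'
  proof -
    have "-1 + cos (2 * pi * a) = 1 - cos (2 * pi * b')"
      using that by (simp add: gam_def complex_eq_iff)
    then have "cos (2 * pi * a) = 1"
      using cos_le_one[of "2 * pi * a"] cos_le_one[of "2 * pi * b'"] by linarith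
    then show ?thesis using cos_one_sin_zero[of "2 * pi * a"] by (simp add: complex_eq_iff)
  qed
  then have "gam GA a' = wedge_pt" if "gam GA a' = gam GB b'" for a' b'
    using that by (simp add: gam_def wedge_pt_def)
  then show ?thesis using assms by (cases c; cases d) metis+
qed

section \<open>Right germs of paths and lifts of paths to the line\<close>

text \<open>Only germs to the right are needed: the substitutions are used through the first letters of
  their words, and backward time is reduced to forward time.\<close>

definition rgerm :: "(real \<Rightarrow> complex) \<Rightarrow> real \<Rightarrow> gen \<Rightarrow> bool" where
  "rgerm g t c \<longleftrightarrow> (\<exists>\<epsilon>>0. \<exists>\<alpha>. continuous_on {t..t+\<epsilon>} \<alpha> \<and> strict_mono_on {t..t+\<epsilon>} \<alpha> \<and>
     (\<forall>s\<in>{t..t+\<epsilon>}. g s = gam c (\<alpha> s)))"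

lemma rgermE:
  assumes "rgerm g t c"
  obtains \<epsilon> \<alpha> where "\<epsilon> > 0" "continuous_on {t..t+\<epsilon>} \<alpha>" "strict_mono_on {t..t+\<epsilon>} \<alpha>"
    "\<And>s. s \<in> {t..t+\<epsilon>} \<Longrightarrow> g s = gam c (\<alpha> s)"
  using assms unfolding rgerm_def by blast

lemma rgerm_at: "rgerm g t c \<Longrightarrow> \<exists>a. g t = gam c a"
  unfolding rgerm_def by (metis atLeastAtMost_iff le_add_same_cancel1 less_eq_real_def order_refl)

text \<open>Keeps the right half of \<open>positive_path\<close>, with continuity and values in
  \<open>W2\<close> built in. In this form the class is closed under composition with the bonding
  maps.\<close>

definition rpath :: "(real \<Rightarrow> complex) \<Rightarrow> bool" where
  "rpath g \<longleftrightarrow> continuous_on UNIV g \<and> range g \<subseteq> W2 \<and> (\<forall>t. \<exists>c. rgerm g t c)"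

lemma continuous_Ints_valued_constant:
  fixes f :: "real \<Rightarrow> real"
  assumes "connected S" "continuous_on S f" "\<And>x. x \<in> S \<Longrightarrow> f x \<in> \<int>" "x \<in> S" "y \<in> S"
  shows "f x = f y"
proof -
  have "f constant_on S"
  proof (rule continuous_discrete_range_constant[OF assms(1,2)])
    fix x assume "x \<in> S"
    have "1 \<le> norm (f y - f x)" if "y \<in> S" "f y \<noteq> f x" for y
    proof -
      obtain m n :: int where "f y = of_int m" "f x = of_int n"
        using assms(3)[OF \<open>x \<in> S\<close>] assms(3)[OF \<open>y \<in> S\<close>] by (auto elim!: Ints_cases)
      then show ?thesis using that by (simp flip: of_int_diff of_int_abs)
    qed
    then show "\<exists>e>0. \<forall>y. y \<in> S \<and> f y \<noteq> f x \<longrightarrow> e \<le> norm (f y - f x)"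
      by (intro exI[of _ 1]) auto
  qed
  then show ?thesis using assms(4,5) by (auto simp: constant_on_def)
qed

text \<open>Uniqueness of lifts: the difference of two lifts is continuous and takes integer
  values.\<close>

lemma lifts_differ_by_constant:
  fixes f g :: "real \<Rightarrow> real"
  assumes "connected S" "continuous_on S f" "continuous_on S g"
    "\<And>x. x \<in> S \<Longrightarrow> cis (2 * pi * f x) = cis (2 * pi * g x)" "x \<in> S" "y \<in> S"
  shows "f x - g x = f y - g y"
  by (rule continuous_Ints_valued_constant[OF assms(1) _ _ assms(5,6)])
    (use assms in \<open>auto intro!: continuous_intros simp: cis_eq_iff_Ints\<close>)

text \<open>A maximum of \<open>G\<close> over a compact interval can be attained at the right end
  only, since from any other point \<open>G\<close> rises further just afterwards.\<close>

lemma strict_mono_if_right_increasing: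
  fixes G :: "real \<Rightarrow> real"
  assumes "continuous_on UNIV G" "\<And>t. \<exists>\<epsilon>>0. \<forall>s\<in>{t<..t+\<epsilon>}. G t < G s"
  shows "strict_mono G"
proof (rule strict_monoI)
  fix a b :: real assume "a < b"
  have "continuous_on {a..b} G" using assms(1) continuous_on_subset by blast
  then obtain m where m: "m \<in> {a..b}" "\<And>y. y \<in> {a..b} \<Longrightarrow> G y \<le> G m"
    using continuous_attains_sup[of "{a..b}" G] \<open>a < b\<close> by auto
  have *: "z = b" if z: "z \<in> {a..b}" "G z = G m" for z
  proof (rule ccontr)
    assume "z \<noteq> b"
    obtain \<epsilon> where "\<epsilon> > 0" "\<forall>s\<in>{z<..z+\<epsilon>}. G z < G s" using assms(2) by blast
    then have "G z < G (min b (z + \<epsilon>))" using z \<open>z \<noteq> b\<close> by auto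
    moreover have "G (min b (z + \<epsilon>)) \<le> G m" using m(2) z \<open>\<epsilon> > 0\<close> by auto
    ultimately show False using z by simp
  qed
  then have "m = b" using m by blast
  moreover have "G a \<noteq> G m" using *[of a] \<open>a < b\<close> by auto
  ultimately show "G a < G b" using m(2)[of a] \<open>a < b\<close> by auto
qed

text \<open>The winding has modulus 1 along the contractible line, so it has a continuous logarithm,
  whose imaginary part gives \<open>G\<close>. Just to the right of each time, \<open>G\<close>
  differs by a constant from the increasing parameter of the germ.\<close>

lemma rpath_lift:
  assumes "rpath g"
  obtains G where "continuous_on UNIV G" "strict_mono G" "\<And>t. wind (g t) = cis (2 * pi * G t)"
proof -
  have g: "continuous_on UNIV g" "range g \<subseteq> W2" using assms by (auto simp: rpath_def)
  have n: "norm (wind (g t)) = 1" for t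
    using g(2) W2_cases[of "g t"] wind_gam by (metis norm_cis rangeI subsetD)
  have "continuous_on UNIV (\<lambda>t. wind (g t))"
    using continuous_on_compose2[OF continuous_on_wind g(1)] g(2) by auto
  moreover have "contractible (UNIV :: real set)" by (simp add: convex_imp_contractible)
  moreover have "wind (g t) \<noteq> 0" for t using n[of t] by auto
  ultimately obtain L where L: "continuous_on UNIV L" "\<And>t. wind (g t) = exp (L t)"
    by (metis UNIV_I continuous_logarithm_on_contractible)
  define G where "G t = Im (L t) / (2 * pi)" for t
  have cG: "continuous_on UNIV G" unfolding G_def using L(1) by (intro continuous_intros) auto
  have wG: "wind (g t) = cis (2 * pi * G t)" for t
  proof -
    have "exp (Re (L t)) = 1" using n[of t] L(2)[of t] by simp
    then show ?thesis using L(2)[of t] by (simp add: G_def exp_eq_polar)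
  qed
  have "strict_mono G"
  proof (rule strict_mono_if_right_increasing[OF cG])
    fix t
    obtain c \<epsilon> \<alpha> where e: "\<epsilon> > 0" "continuous_on {t..t+\<epsilon>} \<alpha>" "strict_mono_on {t..t+\<epsilon>} \<alpha>"
       "\<And>s. s \<in> {t..t+\<epsilon>} \<Longrightarrow> g s = gam c (\<alpha> s)"
      using assms unfolding rpath_def by (metis rgermE)
    have "G t < G s" if s: "s \<in> {t<..t+\<epsilon>}" for s
    proof -
      have "G t - \<alpha> t = G s - \<alpha> s"
      proof (rule lifts_differ_by_constant[of "{t..t+\<epsilon>}"])
        show "continuous_on {t..t+\<epsilon>} G" using cG continuous_on_subset by blast
        show "cis (2 * pi * G x) = cis (2 * pi * \<alpha> x)" if "x \<in> {t..t+\<epsilon>}" for x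
          using wG[of x] e(4)[OF that] wind_gam by metis
      qed (use s e in auto)
      moreover have "\<alpha> t < \<alpha> s" using strict_mono_onD[OF e(3)] s e(1) by auto
      ultimately show ?thesis by linarith
    qed
    then show "\<exists>\<epsilon>>0. \<forall>s\<in>{t<..t+\<epsilon>}. G t < G s" using e(1) by blast
  qed
  then show ?thesis using that cG wG by blast
qed

text \<open>By continuity and monotonicity \<open>\<alpha>\<close> maps a short interval to the
  right of \<open>t\<close> into the domain of the germ of \<open>G\<close>, so the two parameters
  compose.\<close>

lemma rgerm_compose:
  assumes "0 < \<epsilon>" "continuous_on {t..t+\<epsilon>} \<alpha>" "strict_mono_on {t..t+\<epsilon>} \<alpha>"
    and g: "\<And>s. s \<in> {t..t+\<epsilon>} \<Longrightarrow> g s = G (\<alpha> s)"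
    and "rgerm G (\<alpha> t) d"
  shows "rgerm g t d"
proof -
  obtain \<delta> h where h: "\<delta> > 0" "continuous_on {\<alpha> t..\<alpha> t+\<delta>} h" "strict_mono_on {\<alpha> t..\<alpha> t+\<delta>} h"
    "\<And>s. s \<in> {\<alpha> t..\<alpha> t+\<delta>} \<Longrightarrow> G s = gam d (h s)"
    using assms(5) unfolding rgerm_def by blast
  obtain e where e: "e > 0" "\<And>s. s \<in> {t..t+\<epsilon>} \<Longrightarrow> dist s t < e \<Longrightarrow> dist (\<alpha> s) (\<alpha> t) < \<delta>"
    using assms(2)[unfolded continuous_on_iff, rule_format, of t \<delta>] assms(1) h(1) by auto
  define \<eta> where "\<eta> = min \<epsilon> (e/2)"
  have \<eta>: "\<eta> > 0" "\<eta> \<le> \<epsilon>" "\<eta> < e" using e(1) assms(1) by (auto simp: \<eta>_def)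
  have sub: "{t..t+\<eta>} \<subseteq> {t..t+\<epsilon>}" using \<eta> by auto
  have im: "\<alpha> s \<in> {\<alpha> t..\<alpha> t+\<delta>}" if "s \<in> {t..t+\<eta>}" for s
  proof -
    have "\<alpha> t \<le> \<alpha> s"
      using strict_mono_onD[OF assms(3), of t s] that sub \<open>0 < \<epsilon>\<close> by (cases "s = t") auto
    moreover have "dist (\<alpha> s) (\<alpha> t) < \<delta>" using e(2)[of s] that sub \<eta>(3) by (auto simp: dist_real_def)
    ultimately show ?thesis by (auto simp: dist_real_def)
  qed
  have "continuous_on {t..t+\<eta>} (\<lambda>s. h (\<alpha> s))"
    by (rule continuous_on_compose2[OF h(2) continuous_on_subset[OF assms(2) sub]]) (use im in blast)
  moreover have "strict_mono_on {t..t+\<eta>} (\<lambda>s. h (\<alpha> s))"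
  proof (rule strict_mono_onI)
    fix r s assume rs: "r \<in> {t..t+\<eta>}" "s \<in> {t..t+\<eta>}" "r < s"
    then have "\<alpha> r < \<alpha> s" using strict_mono_onD[OF assms(3)] sub by blast
    then show "h (\<alpha> r) < h (\<alpha> s)" using strict_mono_onD[OF h(3)] im rs by blast
  qed
  moreover have "g s = gam d (h (\<alpha> s))" if "s \<in> {t..t+\<eta>}" for s
    using g[of s] h(4)[OF im[OF that]] that sub by auto
  ultimately show ?thesis unfolding rgerm_def using \<eta>(1)
    by (intro exI[of _ \<eta>] conjI exI[of _ "\<lambda>s. h (\<alpha> s)"]) auto
qed

lemma rgerm_cong:
  assumes "rgerm g t c" "\<And>s. s \<ge> t \<Longrightarrow> g s = g' s"
  shows "rgerm g' t c"
proof -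
  obtain \<epsilon> \<alpha> where e: "\<epsilon> > 0" "continuous_on {t..t+\<epsilon>} \<alpha>" "strict_mono_on {t..t+\<epsilon>} \<alpha>"
       "\<And>s. s \<in> {t..t+\<epsilon>} \<Longrightarrow> g s = gam c (\<alpha> s)"
    using assms(1) unfolding rgerm_def by blast
  then show ?thesis using assms(2) unfolding rgerm_def
    by (intro exI[of _ \<epsilon>] conjI exI[of _ \<alpha>]) auto
qed

lemma rgerm_translate:
  assumes "rgerm g (t + a) c"
  shows "rgerm (\<lambda>s. g (s + a)) t c"
proof (rule rgerm_compose[of 1 t "\<lambda>s. s + a" _ g])
  show "strict_mono_on {t..t+1} (\<lambda>s. s + a)" by (auto intro: strict_mono_onI)
qed (use assms in \<open>auto intro: continuous_intros\<close>)

text \<open>Modulo 1 the parameter \<open>s0\<close> falls into one piece of the subdivision that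
  realises the word, and the image continues along the circle named by the letter of that piece. An
  integer falls at the start of the first piece; this is how first letters enter the proof.\<close>

lemma rgerm_realizes_word:
  assumes "realizes_word f c w" "w \<noteq> []"
  shows "\<exists>d. rgerm (\<lambda>s. f (gam c s)) s0 d \<and> (s0 \<in> \<int> \<longrightarrow> d = hd w)"
proof -
  obtain t :: "nat \<Rightarrow> real" where t: "t 0 = 0" "t (length w) = 1" 
    and tk: "\<And>k. k < length w \<Longrightarrow> t k < t (Suc k) \<and>
           (\<exists>h. continuous_on {t k .. t (Suc k)} h \<and> strict_mono_on {t k .. t (Suc k)} h \<and>
                h (t k) = 0 \<and> h (t (Suc k)) = 1 \<and>
                (\<forall>s \<in> {t k .. t (Suc k)}. f (gam c s) = gam (w ! k) (h s)))"
    using assms(1) unfolding realizes_word_def by blast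
  define s where "s = frac s0"
  have s: "0 \<le> s" "s < 1" by (auto simp: s_def frac_lt_1)
  have "\<exists>k<length w. t k \<le> s \<and> s < t (Suc k) \<and> (s0 \<in> \<int> \<longrightarrow> k = 0)"
  proof (cases "s0 \<in> \<int>")
    case True
    then have "s = 0" by (simp add: s_def)
    then show ?thesis using tk[of 0] t assms(2) by (intro exI[of _ 0]) auto
  next
    case False
    \<comment> \<open>Since \<open>t 0 = 0 \<le> s\<close>, the least such \<open>k\<close> is a
      successor, and its predecessor indexes the half-open piece containing
      \<open>s\<close>.\<close>
    define k where "k = (LEAST k. s < t k)"
    have "s < t (length w)" using t s by simp
    then have k: "s < t k" "k \<le> length w" "\<And>j. j < k \<Longrightarrow> \<not> s < t j"
      unfolding k_def by (auto intro: LeastI Least_le dest: not_less_Least)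
    have "k \<noteq> 0" using k(1) t s by (metis not_less)
    then obtain j where "k = Suc j" by (cases k) auto
    then show ?thesis using k(1,2) k(3)[of j] False by (intro exI[of _ j]) auto
  qed
  then obtain k where k: "k < length w" "t k \<le> s" "s < t (Suc k)" "s0 \<in> \<int> \<longrightarrow> k = 0" by blast
  obtain h where h: "continuous_on {t k .. t (Suc k)} h" "strict_mono_on {t k .. t (Suc k)} h"
      "\<forall>s \<in> {t k .. t (Suc k)}. f (gam c s) = gam (w ! k) (h s)" using tk[OF k(1)] by blast
  have sub: "{s..s + (t (Suc k) - s)} \<subseteq> {t k .. t (Suc k)}" using k by auto
  have "rgerm (\<lambda>s. f (gam c s)) s (w ! k)"
    unfolding rgerm_def
    using h k(3) sub continuous_on_subset[OF h(1) sub] monotone_on_subset[OF h(2) sub]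
    by (intro exI[of _ "t (Suc k) - s"] conjI exI[of _ h]) auto
  moreover have "s = s0 + (- of_int \<lfloor>s0\<rfloor>)" by (simp add: s_def frac_def)
  ultimately have "rgerm (\<lambda>x. f (gam c (x + (- of_int \<lfloor>s0\<rfloor>)))) s0 (w ! k)"
    using rgerm_translate[of "\<lambda>s. f (gam c s)" s0 "- of_int \<lfloor>s0\<rfloor>"] by simp
  moreover have "gam c (x + (- of_int \<lfloor>s0\<rfloor>)) = gam c x" for x by (rule gam_periodic) simp
  ultimately show ?thesis using k(4) assms(2) by (auto simp: hd_conv_nth)
qed

section \<open>Maps of the wedge whose two words share their first letter\<close>

text \<open>Abstracts from the particular substitution and retains the common first letter
  \<open>e\<close> of both words: the image of every path that leaves the wedge point departs along
  the circle \<open>e\<close>.\<close>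

definition wedge_map :: "gen \<Rightarrow> (complex \<Rightarrow> complex) \<Rightarrow> bool" where
  "wedge_map e f \<longleftrightarrow> continuous_on W2 f \<and> f ` W2 \<subseteq> W2 \<and> f wedge_pt = wedge_pt \<and>
     (\<forall>c. \<exists>w. w \<noteq> [] \<and> hd w = e \<and> realizes_word f c w)"

lemma wedge_map_rgerm:
  assumes "wedge_map e f"
  shows "\<exists>d. rgerm (\<lambda>s. f (gam c s)) s0 d \<and> (s0 \<in> \<int> \<longrightarrow> d = e)"
  using assms rgerm_realizes_word unfolding wedge_map_def by metis

lemma rpath_wedge_map:
  assumes "wedge_map e f" "rpath g"
  shows "rpath (\<lambda>t. f (g t))"
proof -
  have f: "continuous_on W2 f" "f ` W2 \<subseteq> W2" using assms(1) by (auto simp: wedge_map_def)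
  have g: "continuous_on UNIV g" "range g \<subseteq> W2" using assms(2) by (auto simp: rpath_def)
  have "\<exists>d. rgerm (\<lambda>t. f (g t)) t d" for t
  proof -
    obtain c \<epsilon> \<alpha> where e: "\<epsilon> > 0" "continuous_on {t..t+\<epsilon>} \<alpha>" "strict_mono_on {t..t+\<epsilon>} \<alpha>"
       "\<And>s. s \<in> {t..t+\<epsilon>} \<Longrightarrow> g s = gam c (\<alpha> s)"
      using assms(2) unfolding rpath_def by (metis rgermE)
    obtain d where "rgerm (\<lambda>s. f (gam c s)) (\<alpha> t) d" using wedge_map_rgerm[OF assms(1)] by blast
    then show ?thesis using rgerm_compose[OF e(1-3), of "\<lambda>t. f (g t)" "\<lambda>s. f (gam c s)"] e(4) by auto
  qed
  moreover have "continuous_on UNIV (\<lambda>t. f (g t))"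
    using continuous_on_compose2[OF f(1) g(1)] g(2) by auto
  ultimately show ?thesis using f g unfolding rpath_def by fast
qed

lemma rpath_gam: "rpath (gam c)"
proof -
  have "continuous_on UNIV (gam c)"
    unfolding gam_def cis_conv_exp by (cases c) (auto intro!: continuous_intros)
  moreover have "rgerm (gam c) t c" for t
    unfolding rgerm_def by (intro exI[of _ 1] conjI exI[of _ "\<lambda>s. s"]) (auto intro: strict_mono_onI)
  ultimately show ?thesis using gam_in_W2 by (auto simp: rpath_def)
qed

text \<open>Off the wedge point the common position determines the circle, so both paths already run
  along the same one. At the wedge point the circles may differ, but both images depart along
  \<open>e\<close>.\<close>

lemma wedge_map_common_rgerm:
  assumes f: "wedge_map e f" and "g t = k t" "rgerm g t c" "rgerm k t d"
  shows "\<exists>b. rgerm (\<lambda>s. f (g s)) t b \<and> rgerm (\<lambda>s. f (k s)) t b"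
proof -
  obtain \<epsilon> \<alpha> where e: "\<epsilon> > 0" "continuous_on {t..t+\<epsilon>} \<alpha>" "strict_mono_on {t..t+\<epsilon>} \<alpha>"
       "\<And>s. s \<in> {t..t+\<epsilon>} \<Longrightarrow> g s = gam c (\<alpha> s)"
    using assms(3) unfolding rgerm_def by blast
  obtain \<delta> \<beta> where e': "\<delta> > 0" "continuous_on {t..t+\<delta>} \<beta>" "strict_mono_on {t..t+\<delta>} \<beta>"
       "\<And>s. s \<in> {t..t+\<delta>} \<Longrightarrow> k s = gam d (\<beta> s)"
    using assms(4) unfolding rgerm_def by blast
  have eq: "gam c (\<alpha> t) = gam d (\<beta> t)" using e(1) e'(1) e(4)[of t] e'(4)[of t] assms(2) by auto
  have "\<exists>b. rgerm (\<lambda>s. f (gam c s)) (\<alpha> t) b \<and> rgerm (\<lambda>s. f (gam d s)) (\<beta> t) b"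
  proof (cases "gam c (\<alpha> t) = wedge_pt")
    case True
    then have "\<alpha> t \<in> \<int>" "\<beta> t \<in> \<int>" using eq gam_eq_wedge_iff by metis+
    then show ?thesis using wedge_map_rgerm[OF f, of c "\<alpha> t"] wedge_map_rgerm[OF f, of d "\<beta> t"] by auto
  next
    case False
    then have cd: "d = c" using gam_eq_imp_same_circle eq by metis
    obtain b where b: "rgerm (\<lambda>s. f (gam c s)) (\<alpha> t) b" using wedge_map_rgerm[OF f] by blast
    \<comment> \<open>On one circle the parameters \<open>\<alpha> t\<close> and
      \<open>\<beta> t\<close> of the common point differ by an integer, so a translation carries
      the germ at one to the germ at the other.\<close>
    have "rgerm (\<lambda>s. f (gam c (s + (\<alpha> t - \<beta> t)))) (\<beta> t) b"
      using rgerm_translate[of "\<lambda>s. f (gam c s)" "\<beta> t" "\<alpha> t - \<beta> t"] b by simp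
    moreover have "gam c (s + (\<alpha> t - \<beta> t)) = gam c s" for s
      using gam_eq_imp_Ints[OF eq] by (intro gam_periodic) simp
    ultimately show ?thesis using b cd by auto
  qed
  then obtain b where "rgerm (\<lambda>s. f (gam c s)) (\<alpha> t) b" "rgerm (\<lambda>s. f (gam d s)) (\<beta> t) b" by blast
  then show ?thesis using rgerm_compose[OF e(1-3), of "\<lambda>t. f (g t)" "\<lambda>s. f (gam c s)"] e(4)
     rgerm_compose[OF e'(1-3), of "\<lambda>t. f (k t)" "\<lambda>s. f (gam d s)"] e'(4) by auto
qed

text \<open>The image of the circle \<open>c\<close> under \<open>\<Phi>\<close> has an injective
  lift \<open>\<eta>\<close>. Equal windings of the images make the values of \<open>\<eta>\<close>
  at the two parameters differ by a constant, and the common starting point makes this constant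
  0.\<close>

lemma rgerm_unique:
  assumes "rpath (\<lambda>s. \<Phi> (gam c s))" "rgerm g t c" "rgerm k t c" "g t = k t"
    and "\<And>s. t \<le> s \<Longrightarrow> wind (\<Phi> (g s)) = wind (\<Phi> (k s))"
  shows "\<exists>\<epsilon>>0. \<forall>s\<in>{t..t+\<epsilon>}. g s = k s"
proof -
  obtain \<eta> where \<eta>: "continuous_on UNIV \<eta>" "strict_mono \<eta>" "\<And>s. wind (\<Phi> (gam c s)) = cis (2 * pi * \<eta> s)"
    using rpath_lift[OF assms(1)] by blast
  obtain \<epsilon> \<alpha> where e: "\<epsilon> > 0" "continuous_on {t..t+\<epsilon>} \<alpha>" 
       "\<And>s. s \<in> {t..t+\<epsilon>} \<Longrightarrow> g s = gam c (\<alpha> s)"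
    using assms(2) unfolding rgerm_def by blast
  obtain \<delta> \<beta> where e': "\<delta> > 0" "continuous_on {t..t+\<delta>} \<beta>"
       "\<And>s. s \<in> {t..t+\<delta>} \<Longrightarrow> k s = gam c (\<beta> s)"
    using assms(3) unfolding rgerm_def by blast
  \<comment> \<open>Shifting \<open>\<beta>\<close> by \<open>n\<close> makes both parameters agree
    at \<open>t\<close>; since \<open>n\<close> is an integer, the path itself is unchanged.\<close>
  define n where "n = \<alpha> t - \<beta> t"
  have n: "n \<in> \<int>" unfolding n_def using e(1) e'(1) e(3)[of t] e'(3)[of t] assms(4)
    by (intro gam_eq_imp_Ints[of c _ c]) auto
  define m where "m = min \<epsilon> \<delta>"
  have m: "m > 0" "{t..t+m} \<subseteq> {t..t+\<epsilon>}" "{t..t+m} \<subseteq> {t..t+\<delta>}" using e(1) e'(1) by (auto simp: m_def)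
  have k: "k s = gam c (\<beta> s + n)" if "s \<in> {t..t+m}" for s
    using e'(3)[of s] gam_periodic[of "\<beta> s" "\<beta> s + n" c] n m(3) that by force
  have "g s = k s" if s: "s \<in> {t..t+m}" for s
  proof -
    have "\<eta> (\<alpha> s) - \<eta> (\<beta> s + n) = \<eta> (\<alpha> t) - \<eta> (\<beta> t + n)"
    proof (rule lifts_differ_by_constant[of "{t..t+m}"])
      show "continuous_on {t..t+m} (\<lambda>s. \<eta> (\<alpha> s))"
        by (rule continuous_on_compose2[OF \<eta>(1) continuous_on_subset[OF e(2) m(2)]]) auto
      show "continuous_on {t..t+m} (\<lambda>s. \<eta> (\<beta> s + n))"
        by (rule continuous_on_compose2[OF \<eta>(1)])
          (auto intro!: continuous_intros continuous_on_subset[OF e'(2) m(3)])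
      show "cis (2 * pi * \<eta> (\<alpha> x)) = cis (2 * pi * \<eta> (\<beta> x + n))" if "x \<in> {t..t+m}" for x
        proof -
        have "x \<in> {t..t+\<epsilon>}" "t \<le> x" using that m(2) by auto
        then show ?thesis
          using \<eta>(3)[of "\<alpha> x"] \<eta>(3)[of "\<beta> x + n"] k[OF that] e(3)[of x] assms(5)[of x] by simp
      qed
    qed (use s m in auto)
    then have "\<alpha> s = \<beta> s + n" using \<eta>(2) by (simp add: n_def strict_mono_eq)
    then show ?thesis using k[OF s] e(3)[of s] s m(2) by auto
  qed
  then show ?thesis using m(1) by blast
qed

section \<open>Agreement of threads whose zeroth terms have the same winding\<close>

text \<open>The supremum of the initial segments contained in \<open>S\<close> lies in
  \<open>S\<close> by closedness, and the extension property does not allow it to stay below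
  \<open>y\<close>.\<close>

lemma right_continuation:
  fixes S :: "real set"
  assumes "closed S" "a \<in> S" "\<And>x. x \<in> S \<Longrightarrow> a \<le> x \<Longrightarrow> x < b \<Longrightarrow> \<exists>\<epsilon>>0. {x..x+\<epsilon>} \<subseteq> S" "y \<in> {a..b}"
  shows "y \<in> S"
proof -
  define T where "T = {x \<in> {a..y}. {a..x} \<subseteq> S}"
  have "a \<in> T" using assms(2,4) by (auto simp: T_def)
  have bd: "bdd_above T" by (auto simp: T_def)
  define m where "m = Sup T"
  have "a \<le> m" unfolding m_def using \<open>a \<in> T\<close> bd by (rule cSup_upper)
  moreover have "m \<le> y" unfolding m_def using \<open>a \<in> T\<close> by (intro cSup_least) (auto simp: T_def)
  ultimately have m: "a \<le> m" "m \<le> y" .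
  have lt: "x \<in> S" if "a \<le> x" "x < m" for x
    using less_cSupD[of T x] \<open>a \<in> T\<close> that unfolding m_def T_def by force
  have "m \<in> S"
  proof (cases "a = m")
    case False
    then have "{a<..<m} \<subseteq> S" "a < m" using lt m by auto
    then have "closure {a<..<m} \<subseteq> S" using assms(1) closure_minimal by blast
    then show ?thesis using \<open>a < m\<close> by auto
  qed (use assms in auto)
  have "\<not> m < y"
  proof
    assume "m < y"
    then obtain \<epsilon> where \<epsilon>: "\<epsilon> > 0" "{m..m+\<epsilon>} \<subseteq> S" using assms(3)[OF \<open>m \<in> S\<close>] m assms(4) by auto
    define z where "z = min y (m + \<epsilon>)"
    have "z \<in> T" unfolding T_def
    proof (intro CollectI conjI subsetI)
      show "z \<in> {a..y}" using m \<epsilon> by (auto simp: z_def)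
      show "x \<in> S" if "x \<in> {a..z}" for x
        using that lt[of x] \<epsilon>(2) by (cases "x < m") (auto simp: z_def)
    qed
    then have "z \<le> m" unfolding m_def using bd by (rule cSup_upper)
    then show False using \<open>m < y\<close> \<epsilon> by (auto simp: z_def)
  qed
  then show ?thesis using \<open>m \<in> S\<close> m by auto
qed

text \<open>The bonding map of the inverse system from level \<open>m\<close> down to level
  0.\<close>

fun comp_upto :: "(nat \<Rightarrow> 'a \<Rightarrow> 'a) \<Rightarrow> nat \<Rightarrow> 'a \<Rightarrow> 'a" where
  "comp_upto F 0 z = z"
| "comp_upto F (Suc m) z = comp_upto F m (F m z)"

lemma comp_upto_thread:
  assumes "\<And>i. z i = F i (z (Suc i))"
  shows "comp_upto F m (z m) = z 0"
  by (induction m) (simp_all flip: assms)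

lemma comp_upto_fixed: "(\<And>i. F i w = w) \<Longrightarrow> comp_upto F m w = w"
  by (induction m) auto

lemma rpath_comp_upto:
  assumes "\<And>i. \<exists>e. wedge_map e (F i)" "rpath g"
  shows "rpath (\<lambda>t. comp_upto F m (g t))"
  using assms(2)
proof (induction m arbitrary: g)
  case (Suc m)
  obtain e where "wedge_map e (F m)" using assms(1) by blast
  then show ?case using Suc.IH[OF rpath_wedge_map[OF _ Suc.prems]] by simp
qed simp

text \<open>At each level agreement extends a little to the right, but by an amount that may depend
  on the level and shrink to 0 over all of them. The proof therefore works on the interval before
  the next visit of \<open>g 0\<close> to the wedge point, which is common to all levels.\<close>

lemma threads_agree:
  fixes g k :: "nat \<Rightarrow> real \<Rightarrow> complex"
  assumes F: "\<And>i. \<exists>e. wedge_map e (F i)"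
    and g: "\<And>i. continuous_on {0..} (g i)" "\<And>i t. 0 \<le> t \<Longrightarrow> \<exists>c. rgerm (g i) t c"
      "\<And>i t. 0 \<le> t \<Longrightarrow> g i t = F i (g (Suc i) t)"
    and k: "\<And>i. continuous_on {0..} (k i)" "\<And>i t. 0 \<le> t \<Longrightarrow> \<exists>c. rgerm (k i) t c"
      "\<And>i t. 0 \<le> t \<Longrightarrow> k i t = F i (k (Suc i) t)"
    and w: "\<And>t. 0 \<le> t \<Longrightarrow> wind (g 0 t) = wind (k 0 t)"
    and start: "\<And>i. g i 0 = k i 0" and "0 \<le> t"
  shows "g i t = k i t"
proof -
  define E where "E m = {t \<in> {0..}. g m t = k m t}" for m
  have clE: "closed (E m)" for m unfolding E_def
    using continuous_closed_preimage_constant[of "{0..}" "\<lambda>t. g m t - k m t" 0] g(1) k(1)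
    by (auto intro: continuous_intros)
  \<comment> \<open>Two germs along the same circle must coincide, because their images at level 0
    have the same winding.\<close>
  have same: "\<exists>\<epsilon>>0. {t..t+\<epsilon>} \<subseteq> E m" 
    if "t \<in> E m" "rgerm (g m) t c" "rgerm (k m) t c" for m t c
  proof -
    have "t \<ge> 0" using that(1) by (auto simp: E_def)
    have "\<exists>\<epsilon>>0. \<forall>s\<in>{t..t+\<epsilon>}. g m s = k m s"
    proof (rule rgerm_unique[OF _ that(2,3)])
      show "rpath (\<lambda>s. comp_upto F m (gam c s))" by (rule rpath_comp_upto[OF F rpath_gam])
      show "g m t = k m t" using that by (simp add: E_def)
      fix s assume "t \<le> s"
      then have "0 \<le> s" using \<open>t \<ge> 0\<close> by simp
      then have "comp_upto F m (g m s) = g 0 s" "comp_upto F m (k m s) = k 0 s"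
        using comp_upto_thread[of "\<lambda>i. g i s" F m] comp_upto_thread[of "\<lambda>i. k i s" F m] g(3) k(3)
        by blast+
      then show "wind (comp_upto F m (g m s)) = wind (comp_upto F m (k m s))"
        using w \<open>0 \<le> s\<close> by simp
    qed
    then show ?thesis using \<open>t \<ge> 0\<close> by (force simp: E_def)
  qed
  \<comment> \<open>One level is given up: the germs at level \<open>Suc m\<close> may lie on
    different circles, but their images at level \<open>m\<close> share one.\<close>
  have step: "\<exists>\<epsilon>>0. {t..t+\<epsilon>} \<subseteq> E m" if t: "t \<in> E (Suc m)" for m t
  proof -
    have "t \<ge> 0" "g (Suc m) t = k (Suc m) t" using t by (auto simp: E_def)
    obtain e where e: "wedge_map e (F m)" using F by blast
    obtain c d where "rgerm (g (Suc m)) t c" "rgerm (k (Suc m)) t d" using g(2) k(2) \<open>t \<ge> 0\<close> by meson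
    then obtain b where b: "rgerm (\<lambda>s. F m (g (Suc m) s)) t b" "rgerm (\<lambda>s. F m (k (Suc m) s)) t b"
      using wedge_map_common_rgerm[where g = "g (Suc m)" and k = "k (Suc m)", OF e \<open>g (Suc m) t = k (Suc m) t\<close>] by blast
    have "rgerm (g m) t b" using \<open>t \<ge> 0\<close> by (intro rgerm_cong[OF b(1)]) (simp add: g(3)[of _ m])
    moreover have "rgerm (k m) t b" using \<open>t \<ge> 0\<close> by (intro rgerm_cong[OF b(2)]) (simp add: k(3)[of _ m])
    moreover have "t \<in> E m" using t g(3)[of t m] k(3)[of t m] by (simp add: E_def)
    ultimately show ?thesis using same by blast
  qed
  \<comment> \<open>All bonding maps fix the wedge point. Being off it at level 0 therefore means
    being off it at level \<open>m\<close>, where the position then determines the circle.\<close>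
  have off: "\<exists>\<epsilon>>0. {t..t+\<epsilon>} \<subseteq> E m" if t: "t \<in> E m" "g 0 t \<noteq> wedge_pt" for m t
  proof -
    have "t \<ge> 0" and eq: "g m t = k m t" using t by (auto simp: E_def)
    have "F i wedge_pt = wedge_pt" for i using F[of i] by (auto simp: wedge_map_def)
    then have "comp_upto F m wedge_pt = wedge_pt" by (rule comp_upto_fixed)
    moreover have "comp_upto F m (g m t) = g 0 t"
      using comp_upto_thread[of "\<lambda>i. g i t" F m] g(3) \<open>t \<ge> 0\<close> by blast
    ultimately have nw: "g m t \<noteq> wedge_pt" using t by auto
    obtain c d where c: "rgerm (g m) t c" "rgerm (k m) t d" using g(2) k(2) \<open>t \<ge> 0\<close> by meson
    then obtain a b where "g m t = gam c a" "k m t = gam d b"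
      using rgerm_at by blast
    then have "c = d" using gam_eq_imp_same_circle eq nw by metis
    then show ?thesis using same t(1) c by blast
  qed
  have all: "\<exists>\<epsilon>>0. {t..t+\<epsilon>} \<subseteq> (\<Inter>m. E m)" if t: "t \<in> (\<Inter>m. E m)" for t
  proof -
    have "t \<ge> 0" using t by (auto simp: E_def)
    obtain c \<delta> \<alpha> where e: "\<delta> > 0" "continuous_on {t..t+\<delta>} \<alpha>" "strict_mono_on {t..t+\<delta>} \<alpha>"
       "\<And>s. s \<in> {t..t+\<delta>} \<Longrightarrow> g 0 s = gam c (\<alpha> s)"
      using g(2)[OF \<open>t \<ge> 0\<close>, of 0] unfolding rgerm_def by blast
    \<comment> \<open>The first integer beyond \<open>\<alpha> t\<close>. As long as
      \<open>\<alpha>\<close> stays below it, \<open>g 0\<close> does not return to the wedge point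
      after time \<open>t\<close>.\<close>
    define n where "n = real_of_int \<lfloor>\<alpha> t\<rfloor> + 1"
    have "\<alpha> t < n" "n - 1 \<le> \<alpha> t" by (auto simp: n_def)
    then obtain d where d: "d > 0" "\<And>s. s \<in> {t..t+\<delta>} \<Longrightarrow> dist s t < d \<Longrightarrow> dist (\<alpha> s) (\<alpha> t) < n - \<alpha> t"
      using e(2)[unfolded continuous_on_iff, rule_format, of t "n - \<alpha> t"] e(1) by auto
    define r where "r = min \<delta> d"
    have "r > 0" using e d by (simp add: r_def)
    have nw: "g 0 s \<noteq> wedge_pt" if s: "t < s" "s < t + r" for s
    proof -
      have "s \<in> {t..t+\<delta>}" "dist s t < d" using s by (auto simp: r_def dist_real_def)
      then have "\<alpha> s < n" using d(2)[of s] by (auto simp: dist_real_def)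
      moreover have "\<alpha> t < \<alpha> s" using strict_mono_onD[OF e(3)] s \<open>s \<in> _\<close> by auto
      ultimately have "\<lfloor>\<alpha> t\<rfloor> < \<alpha> s" "\<alpha> s < \<lfloor>\<alpha> t\<rfloor> + 1" using \<open>n - 1 \<le> \<alpha> t\<close> unfolding n_def by linarith+
      then have "\<alpha> s \<notin> \<int>" by (auto elim!: Ints_cases)
      then show ?thesis using e(4)[OF \<open>s \<in> _\<close>] gam_eq_wedge_iff by simp
    qed
    \<comment> \<open>Agreement at all levels is available at time \<open>t\<close>, which may be a
      visit to the wedge point, so \<open>step\<close> applies there. At later times each level
      continues on its own by \<open>off\<close>.\<close>
    have "s \<in> E m" if "s \<in> {t..t+r}" for s m
    proof (rule right_continuation[OF clE _ _ that])
      show "t \<in> E m" using t by blast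
      fix x assume x: "x \<in> E m" "t \<le> x" "x < t + r"
      show "\<exists>\<epsilon>>0. {x..x+\<epsilon>} \<subseteq> E m"
      proof (cases "x = t")
        case True
        then show ?thesis using step t by blast
      next
        case False
        then show ?thesis using off nw x by simp
      qed
    qed
    then show ?thesis using \<open>r > 0\<close> by blast
  qed
  have "t \<in> (\<Inter>m. E m)"
  proof (rule right_continuation[of _ 0 t])
    show "closed (\<Inter>m. E m)" using clE by blast
    show "0 \<in> (\<Inter>m. E m)" using start by (auto simp: E_def)
  qed (use all \<open>0 \<le> t\<close> in auto)
  then show ?thesis by (auto simp: E_def)
qed


section \<open>Orbits of a flow seen through the projections of an expansion\<close>

lemma flow_in_topspace: "is_flow X \<phi> \<Longrightarrow> x \<in> topspace X \<Longrightarrow> \<phi> t x \<in> topspace X"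
  unfolding is_flow_def continuous_map_def by (auto simp: Pi_iff)

lemma flow_continuous_orbit:
  assumes "is_flow X \<phi>" "x \<in> topspace X"
  shows "continuous_map euclideanreal X (\<lambda>t. \<phi> t x)"
proof -
  have "continuous_map euclideanreal (prod_topology euclideanreal X) (\<lambda>t. (t, x))"
    using assms(2) by (auto intro: continuous_map_pairedI)
  then have "continuous_map euclideanreal X ((\<lambda>(t, x). \<phi> t x) \<circ> (\<lambda>t. (t, x)))"
    using assms(1) unfolding is_flow_def by (intro continuous_map_compose) auto
  then show ?thesis by (simp add: o_def)
qed

lemma flow_continuous_time:
  assumes "is_flow X \<phi>"
  shows "continuous_map X X (\<phi> t)"
proof -
  have "continuous_map X (prod_topology euclideanreal X) (\<lambda>x. (t, x))"
    by (auto intro: continuous_map_pairedI)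
  then have "continuous_map X X ((\<lambda>(t, x). \<phi> t x) \<circ> (\<lambda>x. (t, x)))"
    using assms(1) unfolding is_flow_def by (intro continuous_map_compose) auto
  then show ?thesis by (simp add: o_def)
qed

lemma flow_add: "is_flow X \<phi> \<Longrightarrow> x \<in> topspace X \<Longrightarrow> \<phi> s (\<phi> t x) = \<phi> (s + t) x"
  by (simp add: is_flow_def)

lemma flow_zero: "is_flow X \<phi> \<Longrightarrow> x \<in> topspace X \<Longrightarrow> \<phi> 0 x = x"
  by (simp add: is_flow_def)

lemma rpath_expansion:
  assumes "expansion X \<phi> x0 F p" "is_flow X \<phi>" "x \<in> topspace X"
  shows "rpath (\<lambda>t. p i (\<phi> t x))"
proof -
  have p: "continuous_map X (top_of_set W2) (p i)" "positive_path (\<lambda>t. p i (\<phi> t x))"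
    using assms unfolding expansion_def by auto
  have "continuous_map euclideanreal (top_of_set W2) (p i \<circ> (\<lambda>t. \<phi> t x))"
    by (rule continuous_map_compose[OF flow_continuous_orbit[OF assms(2,3)] p(1)])
  then have "continuous_on UNIV (\<lambda>t. p i (\<phi> t x))" "range (\<lambda>t. p i (\<phi> t x)) \<subseteq> W2"
    by (auto simp: continuous_map_in_subtopology o_def)
  moreover have "\<exists>c. rgerm (\<lambda>t. p i (\<phi> t x)) t c" for t
    using p(2) unfolding positive_path_def rgerm_def by meson
  ultimately show ?thesis by (auto simp: rpath_def)
qed

lemma compact_metrizable_subsequence:
  assumes "compact_space X" "metrizable_space X" "range (\<sigma> :: nat \<Rightarrow> 'a) \<subseteq> topspace X"
  obtains z r where "z \<in> topspace X" "strict_mono (r :: nat \<Rightarrow> nat)" "limitin X (\<sigma> \<circ> r) z sequentially"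
proof -
  obtain S d where S: "Metric_space S d" "X = Metric_space.mtopology S d"
    using assms(2) unfolding metrizable_space_def by blast
  interpret Metric_space S d by fact
  have "compact_space mtopology" "range \<sigma> \<subseteq> S" using assms(1,3) S(2) by auto
  then have "\<exists>l r. l \<in> S \<and> strict_mono (r :: nat \<Rightarrow> nat) \<and> limitin mtopology (\<sigma> \<circ> r) l sequentially"
    unfolding compact_space_sequentially by (elim allE impE)
  then show ?thesis using that unfolding S(2) topspace_mtopology by (elim exE conjE)
qed

text \<open>A bounded \<open>G\<close> would converge to some \<open>L\<close> at infinity. At a
  limit point \<open>z\<close> of the forward orbit, continuity then makes the winding constant
  along the whole orbit of \<open>z\<close>, although this orbit has a strictly increasing lift as
  well.\<close>

lemma lift_unbounded:
  assumes "compact_space X" "metrizable_space X" "is_flow X \<phi>" "continuous_map X (top_of_set W2) q"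
    and rp: "\<And>z. z \<in> topspace X \<Longrightarrow> rpath (\<lambda>t. q (\<phi> t z))"
    and x: "x \<in> topspace X" and G: "strict_mono G" "\<And>t. wind (q (\<phi> t x)) = cis (2 * pi * G t)"
  shows "\<exists>t. M < G t"
proof (rule ccontr)
  assume "\<not> ?thesis"
  then have bd: "bdd_above (range G)" by (auto intro!: bdd_aboveI[of _ M] simp: not_less)
  define L where "L = Sup (range G)"
  have lim: "(G \<longlongrightarrow> L) at_top"
  proof (rule order_tendstoI)
    fix a assume "a < L"
    then obtain t where "a < G t" unfolding L_def using less_cSupD[of "range G" a] by auto
    then have "\<forall>s\<ge>t. a < G s" using strict_mono_less_eq[OF G(1)] by (meson less_le_trans)
    then show "\<forall>\<^sub>F x in at_top. a < G x" unfolding eventually_at_top_linorder by blast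
  next
    fix a assume "L < a"
    then show "\<forall>\<^sub>F x in at_top. G x < a"
      using cSup_upper[OF _ bd] unfolding L_def by (intro always_eventually) (meson le_less_trans rangeI)
  qed
  have "range (\<lambda>n::nat. \<phi> (real n) x) \<subseteq> topspace X"
    using flow_in_topspace[OF assms(3) x] by auto
  then obtain z r where z: "z \<in> topspace X" "strict_mono (r :: nat \<Rightarrow> nat)"
    "limitin X ((\<lambda>n. \<phi> (real n) x) \<circ> r) z sequentially"
    by (rule compact_metrizable_subsequence[OF assms(1,2)])
  have const: "wind (q (\<phi> s z)) = cis (2 * pi * L)" for s
  proof -
    have "continuous_map X (top_of_set W2) (q \<circ> \<phi> s)"
      by (rule continuous_map_compose[OF flow_continuous_time[OF assms(3)] assms(4)])
    moreover have "continuous_map (top_of_set W2) euclidean wind" using continuous_on_wind by simp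
    ultimately have "continuous_map X euclidean (wind \<circ> (q \<circ> \<phi> s))" by (rule continuous_map_compose)
    then have "limitin euclidean ((wind \<circ> (q \<circ> \<phi> s)) \<circ> ((\<lambda>n. \<phi> (real n) x) \<circ> r)) ((wind \<circ> (q \<circ> \<phi> s)) z) sequentially"
      using z(3) by (rule continuous_map_limit)
    moreover have "(wind \<circ> (q \<circ> \<phi> s)) \<circ> ((\<lambda>n. \<phi> (real n) x) \<circ> r) = (\<lambda>n. cis (2 * pi * G (s + real (r n))))"
      using G(2) flow_add[OF assms(3) x] by (auto simp: o_def)
    ultimately have "(\<lambda>n. cis (2 * pi * G (s + real (r n)))) \<longlonglongrightarrow> wind (q (\<phi> s z))" by simp
    moreover have "(\<lambda>n. cis (2 * pi * G (s + real (r n)))) \<longlonglongrightarrow> cis (2 * pi * L)"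
    proof -
      have "filterlim (\<lambda>n. s + real (r n)) at_top sequentially"
        by (intro filterlim_tendsto_add_at_top[OF tendsto_const]
            filterlim_compose[OF filterlim_real_sequentially filterlim_subseq[OF z(2)]])
      then have "(\<lambda>n. G (s + real (r n))) \<longlonglongrightarrow> L" by (rule filterlim_compose[OF lim])
      then show ?thesis unfolding cis_conv_exp by (intro tendsto_intros) auto
    qed
    ultimately show ?thesis using LIMSEQ_unique by blast
  qed
  obtain H where H: "continuous_on UNIV H" "strict_mono H" "\<And>t. wind (q (\<phi> t z)) = cis (2 * pi * H t)"
    using rpath_lift[OF rp[OF z(1)]] by blast
  \<comment> \<open>\<open>H\<close> and the constant function \<open>L\<close> lift the same
    map.\<close>
  have "H 0 - L = H 1 - L"
    by (rule lifts_differ_by_constant[of UNIV]) (use H const in auto)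
  moreover have "H 0 < H 1" using strict_monoD[OF H(2), of 0 1] by simp
  ultimately show False by simp
qed

text \<open>The time change is \<open>inv K\<close> after \<open>G\<close>, which equalises the
  windings of the zeroth projections; \<open>threads_agree\<close> then transfers this to all
  levels.\<close>

lemma threads_follow:
  assumes F: "\<And>i. \<exists>e. wedge_map e (F i)"
    and X: "flow_space X \<phi>" "expansion X \<phi> x0 F p" "x \<in> topspace X"
    and Y: "flow_space Y \<psi>" "expansion Y \<psi> y0 F q" "y \<in> topspace Y"
    and start: "\<And>i. p i x = q i y"
    and G: "continuous_on UNIV G" "strict_mono G" "\<And>t. wind (p 0 (\<phi> t x)) = cis (2 * pi * G t)"
    and K: "continuous_on UNIV K" "strict_mono K" "\<And>t. wind (q 0 (\<psi> t y)) = cis (2 * pi * K t)"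
    and GK: "G 0 = K 0" and "0 \<le> t"
  shows "\<exists>u. K u = G t \<and> (\<forall>i. p i (\<phi> t x) = q i (\<psi> u y))"
proof -
  have fl: "is_flow X \<phi>" "is_flow Y \<psi>" using X Y by (auto simp: flow_space_def)
  have cpt: "compact_space Y" "metrizable_space Y" using Y(1) by (auto simp: flow_space_def)
  have q0: "continuous_map Y (top_of_set W2) (q 0)" using Y(2) unfolding expansion_def by blast
  define u where "u t = inv K (G t)" for t
  have injK: "inj K" using K(2) by (rule strict_mono_imp_inj_on)
  \<comment> \<open>\<open>inv K\<close> is meaningful only on the range of \<open>K\<close>. The
    common initial value and the unboundedness of \<open>K\<close> put \<open>G t\<close> into this
    range for \<open>0 \<le> t\<close>.\<close>
  have Ku: "K (u t) = G t" if "0 \<le> t" for t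
  proof -
    obtain M where M: "G t < K M"
      using lift_unbounded[OF cpt fl(2) q0 rpath_expansion[OF Y(2) fl(2)] Y(3) K(2,3)] by blast
    have "K 0 \<le> G t" using GK strict_mono_less_eq[OF G(2), of 0 t] that by simp
    then have "0 \<le> M" using M strict_mono_less_eq[OF K(2), of 0 M] by simp
    then have "\<exists>x\<ge>0. x \<le> M \<and> K x = G t"
      using IVT'[of K 0 "G t" M] \<open>K 0 \<le> G t\<close> M continuous_on_subset[OF K(1)] by auto
    then show ?thesis unfolding u_def by (metis f_inv_into_f rangeI)
  qed
  \<comment> \<open>The 1 is the radius around \<open>s\<close> on which \<open>K\<close> has to be
    continuous and inverted by \<open>inv K\<close>.\<close>
  have cK: "isCont (inv K) (K s)" for s
    by (rule isCont_inverse_function[of 1])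
      (use K(1) injK in \<open>auto simp: continuous_on_eq_continuous_at\<close>)
  have cu: "continuous_on {0..} u"
  proof -
    have "isCont u t" if "0 \<le> t" for t
    proof -
      have "isCont (inv K) (G t)" using cK[of "u t"] Ku[OF that] by simp
      moreover have "isCont G t" using G(1) by (auto simp: continuous_on_eq_continuous_at)
      ultimately show ?thesis unfolding u_def using isCont_o2 by blast
    qed
    then show ?thesis by (auto intro: continuous_at_imp_continuous_on)
  qed
  have smu: "u r < u s" if "0 \<le> r" "r < s" for r s
    using Ku[of r] Ku[of s] strict_mono_less[OF K(2), of "u r" "u s"] strict_mono_less[OF G(2), of r s] that
    by simp
  have u0: "u 0 = 0" unfolding u_def GK using injK by simp
  have rpX: "rpath (\<lambda>t. p i (\<phi> t x))" and rpY: "rpath (\<lambda>t. q i (\<psi> t y))" for i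
    using rpath_expansion[OF X(2) fl(1) X(3)] rpath_expansion[OF Y(2) fl(2) Y(3)] by blast+
  have "p i (\<phi> t x) = q i (\<psi> (u t) y)" for i
  proof (rule threads_agree[OF F, where g = "\<lambda>i t. p i (\<phi> t x)" and k = "\<lambda>i t. q i (\<psi> (u t) y)"])
    show "continuous_on {0..} (\<lambda>t. p i (\<phi> t x))" for i
      using rpX continuous_on_subset unfolding rpath_def by blast
    show "\<exists>c. rgerm (\<lambda>t. p i (\<phi> t x)) t c" for i t
      using rpX unfolding rpath_def by blast
    show "continuous_on {0..} (\<lambda>t. q i (\<psi> (u t) y))" for i
      using continuous_on_compose2[OF _ cu, of UNIV "\<lambda>t. q i (\<psi> t y)"] rpY unfolding rpath_def by blast
    show "\<exists>c. rgerm (\<lambda>t. q i (\<psi> (u t) y)) t c" if "0 \<le> t" for i t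
    proof -
      obtain c where c: "rgerm (\<lambda>t. q i (\<psi> t y)) (u t) c" using rpY unfolding rpath_def by blast
      have "rgerm (\<lambda>t. q i (\<psi> (u t) y)) t c"
      proof (rule rgerm_compose[where \<epsilon> = 1 and \<alpha> = u and G = "\<lambda>t. q i (\<psi> t y)"])
        show "continuous_on {t..t+1} u" using cu that by (rule_tac continuous_on_subset) auto
        show "strict_mono_on {t..t+1} u" using smu that by (auto intro!: strict_mono_onI)
      qed (use c in auto)
      then show ?thesis by blast
    qed
    show "wind (p 0 (\<phi> t x)) = wind (q 0 (\<psi> (u t) y))" if "0 \<le> t" for t
      using G(3) K(3) Ku[OF that] by simp
    show "p i (\<phi> 0 x) = q i (\<psi> (u 0) y)" for i
      using start u0 flow_zero X(3) Y(3) fl by metis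
    show "p i (\<phi> t x) = F i (p (Suc i) (\<phi> t x))" for i t
      using X(2) flow_in_topspace[OF fl(1) X(3)] unfolding expansion_def by blast
    show "q i (\<psi> (u t) y) = F i (q (Suc i) (\<psi> (u t) y))" for i t
      using Y(2) flow_in_topspace[OF fl(2) Y(3)] unfolding expansion_def by blast
  qed fact
  then show ?thesis using Ku \<open>0 \<le> t\<close> by blast
qed

lemma expansion_separates:
  assumes "expansion X \<phi> x0 F p" "x \<in> topspace X" "y \<in> topspace X" "\<And>i. p i x = p i y"
  shows "x = y"
proof -
  have "inj_on (\<lambda>x i. p i x) (topspace X)"
    using assms(1) homeomorphic_imp_injective_map unfolding expansion_def by blast
  then show ?thesis using assms by (auto simp: inj_on_def)
qed

lemma lift_with_initial_value:
  assumes "rpath g" "wind (g 0) = cis (2 * pi * a)"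
  obtains G where "continuous_on UNIV G" "strict_mono G" "\<And>t. wind (g t) = cis (2 * pi * G t)" "G 0 = a"
proof -
  obtain G where G: "continuous_on UNIV G" "strict_mono G" "\<And>t. wind (g t) = cis (2 * pi * G t)"
    using rpath_lift[OF assms(1)] by blast
  have n: "a - G 0 \<in> \<int>" using G(3)[of 0] assms(2) cis_eq_iff_Ints by metis
  show ?thesis
  proof (rule that[of "\<lambda>t. G t + (a - G 0)"])
    show "continuous_on UNIV (\<lambda>t. G t + (a - G 0))" using G(1) by (intro continuous_intros)
    show "strict_mono (\<lambda>t. G t + (a - G 0))" using G(2) by (auto simp: strict_mono_def)
    show "wind (g t) = cis (2 * pi * (G t + (a - G 0)))" for t
      using G(3)[of t] cis_eq_iff_Ints[of "G t + (a - G 0)" "G t"] n by simp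
  qed simp
qed

text \<open>The time change is fixed by matching lifts, \<open>K (\<tau> t) = G t\<close>, and
  inherits monotonicity from them. On a periodic orbit the positions alone would determine it only
  up to periods.\<close>

lemma orbit_follows_orbit:
  assumes F: "\<And>i. \<exists>e. wedge_map e (F i)"
    and X: "flow_space X \<phi>" "expansion X \<phi> x0 F p"
    and Y: "flow_space Y \<psi>" "expansion Y \<psi> y0 F q"
    and h: "\<And>x. x \<in> topspace X \<Longrightarrow> h x \<in> topspace Y" "\<And>x i. x \<in> topspace X \<Longrightarrow> p i x = q i (h x)"
    and x: "x \<in> topspace X"
  shows "\<exists>\<tau>. strict_mono \<tau> \<and> \<tau> 0 = 0 \<and> (\<forall>t. h (\<phi> t x) = \<psi> (\<tau> t) (h x))"
proof -
  have fl: "is_flow X \<phi>" "is_flow Y \<psi>" using X Y by (auto simp: flow_space_def)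
  note rpX = rpath_expansion[OF X(2) fl(1)] and rpY = rpath_expansion[OF Y(2) fl(2)]
  note inX = flow_in_topspace[OF fl(1)] and inY = flow_in_topspace[OF fl(2)]
  obtain G where G: "continuous_on UNIV G" "strict_mono G" "\<And>t. wind (p 0 (\<phi> t x)) = cis (2 * pi * G t)"
    using rpath_lift[OF rpX[OF x]] by blast
  have "wind (q 0 (\<psi> 0 (h x))) = cis (2 * pi * G 0)"
    using h[OF x] G(3)[of 0] flow_zero[OF fl(2) h(1)[OF x]] flow_zero[OF fl(1) x] by metis
  then obtain K where K: "continuous_on UNIV K" "strict_mono K"
      "\<And>t. wind (q 0 (\<psi> t (h x))) = cis (2 * pi * K t)" "K 0 = G 0"
    using lift_with_initial_value[OF rpY[OF h(1)[OF x]]] by blast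
  have "\<exists>u. K u = G t \<and> h (\<phi> t x) = \<psi> u (h x)" for t
  proof (cases "0 \<le> t")
    case True
    obtain u where u: "K u = G t" "\<And>i. p i (\<phi> t x) = q i (\<psi> u (h x))"
      using threads_follow[OF F X x Y h(1)[OF x] h(2)[OF x] G K(1,2,3)] K(4) True by metis
    have "h (\<phi> t x) = \<psi> u (h x)"
      by (rule expansion_separates[OF Y(2)]) (use u(2) h inX inY x in metis)+
    then show ?thesis using u(1) by blast
  next
    case False
    \<comment> \<open>Follow the orbits forward from \<open>\<phi> t x\<close> until they reach \<open>x\<close>.\<close>
    define x' where "x' = \<phi> t x"
    have x': "x' \<in> topspace X" using inX x by (simp add: x'_def)
    have G': "continuous_on UNIV (\<lambda>s. G (s + t))" "strict_mono (\<lambda>s. G (s + t))"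
      "\<And>s. wind (p 0 (\<phi> s x')) = cis (2 * pi * G (s + t))"
      using G flow_add[OF fl(1) x] 
      by (auto simp: x'_def strict_mono_def intro!: continuous_on_compose2[OF G(1)] continuous_intros)
    have "wind (q 0 (\<psi> 0 (h x'))) = cis (2 * pi * G t)"
      using h[OF x'] G(3)[of t] flow_zero[OF fl(2) h(1)[OF x']] by (simp add: x'_def)
    then obtain K' where K': "continuous_on UNIV K'" "strict_mono K'"
        "\<And>s. wind (q 0 (\<psi> s (h x'))) = cis (2 * pi * K' s)" "K' 0 = G t"
      using lift_with_initial_value[OF rpY[OF h(1)[OF x']]] by blast
    have "\<exists>u. K' u = G (- t + t) \<and> (\<forall>i. p i (\<phi> (- t) x') = q i (\<psi> u (h x')))"
      by (rule threads_follow[OF F X x' Y h(1)[OF x'] h(2)[OF x'] G' K'(1,2,3)]) (use K'(4) False in auto)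
    moreover have "\<phi> (- t) x' = x" using flow_add[OF fl(1) x] flow_zero[OF fl(1) x] by (simp add: x'_def)
    ultimately obtain u where u: "K' u = G 0" "\<And>i. p i x = q i (\<psi> u (h x'))"
      by auto
    have hx: "h x = \<psi> u (h x')"
      by (rule expansion_separates[OF Y(2)]) (use u(2) h inY x x' in metis)+
    have flow_back: "\<psi> s (h x') = \<psi> (s - u) (h x)" for s
      using hx flow_add[OF fl(2) h(1)[OF x']] by simp
    \<comment> \<open>\<open>K (s - u)\<close> and \<open>K' s\<close> lift the same path in
      \<open>s\<close>, so their difference is constant. It is 0 at \<open>s = u\<close>, and
      comparison with \<open>s = 0\<close> gives \<open>K (- u) = G t\<close>.\<close>
    have "K (u - u) - K' u = K (0 - u) - K' 0"
    proof (rule lifts_differ_by_constant[of UNIV])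
      show "cis (2 * pi * K (s - u)) = cis (2 * pi * K' s)" for s
        using K(3)[of "s - u"] K'(3)[of s] flow_back[of s] by simp
      show "continuous_on UNIV (\<lambda>s. K (s - u))"
        by (rule continuous_on_compose2[OF K(1)]) (auto intro: continuous_intros)
    qed (use K' in auto)
    then have "K (- u) = G t" using u(1) K(4) K'(4) by simp
    moreover have "h (\<phi> t x) = \<psi> (- u) (h x)"
      using flow_back[of 0] flow_zero[OF fl(2) h(1)[OF x']] by (simp add: x'_def)
    ultimately show ?thesis by blast
  qed
  then obtain \<tau> where \<tau>: "\<And>t. K (\<tau> t) = G t" "\<And>t. h (\<phi> t x) = \<psi> (\<tau> t) (h x)" by metis
  have "strict_mono \<tau>"
    using \<tau>(1) strict_mono_less[OF K(2)] strict_mono_less[OF G(2)] by (metis strict_mono_def)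
  moreover have "\<tau> 0 = 0" using \<tau>(1)[of 0] K(4) strict_mono_eq[OF K(2)] by metis
  ultimately show ?thesis using \<tau>(2) by blast
qed

text \<open>Passing through the common inverse limit gives a homeomorphism that preserves all
  coordinates. Applying \<open>orbit_follows_orbit\<close> to it and to its inverse yields the two
  inclusions between orbits.\<close>

lemma flow_equivalent_if_same_bonds:
  assumes F: "\<And>i. \<exists>e. wedge_map e (F i)"
    and X: "flow_space X \<phi>" "expansion X \<phi> x0 F p"
    and Y: "flow_space Y \<psi>" "expansion Y \<psi> y0 F q"
  shows "flow_equivalent X \<phi> Y \<psi>"
proof -
  have fl: "is_flow X \<phi>" "is_flow Y \<psi>" using X Y by (auto simp: flow_space_def)
  obtain P' where P': "homeomorphic_maps X (inv_limit_top F) (\<lambda>x i. p i x) P'"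
    using X(2) unfolding expansion_def homeomorphic_map_maps by blast
  obtain Q' where Q': "homeomorphic_maps Y (inv_limit_top F) (\<lambda>x i. q i x) Q'"
    using Y(2) unfolding expansion_def homeomorphic_map_maps by blast
  define h where "h = Q' \<circ> (\<lambda>x i. p i x)"
  define k where "k = P' \<circ> (\<lambda>x i. q i x)"
  have hk: "homeomorphic_maps X Y h k"
    unfolding h_def k_def using P' Q' homeomorphic_maps_compose homeomorphic_maps_sym by blast
  then have h: "h x \<in> topspace Y" "k (h x) = x" if "x \<in> topspace X" for x
    using that by (auto simp: homeomorphic_maps_def continuous_map_def)
  have k: "k y \<in> topspace X" "h (k y) = y" if "y \<in> topspace Y" for y
    using hk that by (auto simp: homeomorphic_maps_def continuous_map_def)
  have ph: "p i x = q i (h x)" if "x \<in> topspace X" for x i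
  proof -
    have "(\<lambda>i. p i x) \<in> topspace (inv_limit_top F)"
      using P' that by (auto simp: homeomorphic_maps_def continuous_map_def)
    then have "(\<lambda>i. q i (h x)) = (\<lambda>i. p i x)"
      using Q' by (auto simp: homeomorphic_maps_def h_def)
    then show ?thesis by metis
  qed
  have qk: "q i y = p i (k y)" if "y \<in> topspace Y" for y i
    using ph[OF k(1)[OF that]] k(2)[OF that] by simp
  have fwd: "\<exists>\<tau>. strict_mono \<tau> \<and> \<tau> 0 = 0 \<and> (\<forall>t. h (\<phi> t x) = \<psi> (\<tau> t) (h x))" if "x \<in> topspace X" for x
    by (rule orbit_follows_orbit[OF F X Y]) (use h ph that in auto)
  have bwd: "\<exists>\<tau>. strict_mono \<tau> \<and> \<tau> 0 = 0 \<and> (\<forall>t. k (\<psi> t y) = \<phi> (\<tau> t) (k y))" if "y \<in> topspace Y" for y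
    by (rule orbit_follows_orbit[OF F Y X]) (use k qk that in auto)
  have "h ` orbit \<phi> x = orbit \<psi> (h x)" if x: "x \<in> topspace X" for x
  proof
    show "h ` orbit \<phi> x \<subseteq> orbit \<psi> (h x)" using fwd[OF x] unfolding orbit_def by auto
    show "orbit \<psi> (h x) \<subseteq> h ` orbit \<phi> x"
    proof
      fix z assume "z \<in> orbit \<psi> (h x)"
      then obtain u where z: "z = \<psi> u (h x)" by (auto simp: orbit_def)
      then have "z \<in> topspace Y" using flow_in_topspace[OF fl(2)] h(1)[OF x] by blast
      obtain t where "k z = \<phi> t x" using bwd[OF h(1)[OF x]] h(2)[OF x] z by metis
      then have "z = h (\<phi> t x)" using k(2)[OF \<open>z \<in> topspace Y\<close>] by simp
      then show "z \<in> h ` orbit \<phi> x" by (auto simp: orbit_def)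
    qed
  qed
  then show ?thesis unfolding flow_equivalent_def homeomorphic_map_maps using hk fwd by blast
qed

section \<open>Dropping initial terms of an expansion\<close>

lemma topspace_inv_limit_top: "topspace (inv_limit_top F) = inv_limit F"
  by (auto simp: inv_limit_top_def inv_limit_def)

lemma Hausdorff_space_inv_limit_top: "Hausdorff_space (inv_limit_top F)"
  unfolding inv_limit_top_def
  by (intro Hausdorff_space_subtopology) (simp add: Hausdorff_space_product_topology Hausdorff_space_subtopology)

lemma inv_limit_extend:
  assumes "F 0 ` W2 \<subseteq> W2" "z \<in> inv_limit (\<lambda>i. F (Suc i))"
  shows "case_nat (F 0 (z 0)) z \<in> inv_limit F"
proof -
  define y where "y = case_nat (F 0 (z 0)) z"
  have y: "y 0 = F 0 (z 0)" "\<And>i. y (Suc i) = z i" by (simp_all add: y_def)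
  have zW: "z i \<in> W2" and z: "z i = F (Suc i) (z (Suc i))" for i
    using assms(2) unfolding inv_limit_def by blast+
  have "y i \<in> W2 \<and> y i = F i (y (Suc i))" for i
  proof (cases i)
    case 0
    then show ?thesis using y assms(1) zW by auto
  next
    case (Suc j)
    then show ?thesis using z[of j] zW[of j] y(2)[of j] y(2)[of "Suc j"] by simp
  qed
  then show ?thesis unfolding y_def[symmetric] inv_limit_def by blast
qed

text \<open>The dropped coordinate is recovered from the next one by \<open>F 0\<close>, so the
  remaining projections still separate points and reach every thread. A continuous bijection from a
  compact space to a Hausdorff space is a homeomorphism.\<close>

lemma expansion_Suc:
  assumes "expansion X \<phi> x0 F p" "compact_space X" "F 0 ` W2 \<subseteq> W2"
  shows "expansion X \<phi> x0 (\<lambda>i. F (Suc i)) (\<lambda>i. p (Suc i))"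
proof -
  have im: "(\<lambda>x i. p i x) ` topspace X = inv_limit F"
    using assms(1) homeomorphic_imp_surjective_map topspace_inv_limit_top unfolding expansion_def by metis
  have p: "\<And>i. continuous_map X (top_of_set W2) (p i)" "\<And>i x. x \<in> topspace X \<Longrightarrow> p i x = F i (p (Suc i) x)"
    using assms(1) unfolding expansion_def by blast+
  have pW: "p i x \<in> W2" if "x \<in> topspace X" for i x
    using p(1)[of i] that by (auto simp: continuous_map_in_subtopology)
  have thread: "(\<lambda>i. p (Suc i) x) \<in> inv_limit (\<lambda>i. F (Suc i))" if "x \<in> topspace X" for x
    unfolding inv_limit_def using p(2) pW that by blast
  have "homeomorphic_map X (inv_limit_top (\<lambda>i. F (Suc i))) (\<lambda>x i. p (Suc i) x)"
  proof (rule continuous_imp_homeomorphic_map[OF _ assms(2) Hausdorff_space_inv_limit_top])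
    show "continuous_map X (inv_limit_top (\<lambda>i. F (Suc i))) (\<lambda>x i. p (Suc i) x)"
      unfolding inv_limit_top_def continuous_map_in_subtopology continuous_map_componentwise_UNIV
      using p(1) thread by (auto simp: continuous_map_in_subtopology)
    show "(\<lambda>x i. p (Suc i) x) ` topspace X = topspace (inv_limit_top (\<lambda>i. F (Suc i)))"
      unfolding topspace_inv_limit_top
    proof (intro equalityI subsetI)
      fix z assume "z \<in> (\<lambda>x i. p (Suc i) x) ` topspace X"
      then show "z \<in> inv_limit (\<lambda>i. F (Suc i))" using thread by blast
    next
      fix z assume "z \<in> inv_limit (\<lambda>i. F (Suc i))"
      then have "case_nat (F 0 (z 0)) z \<in> inv_limit F" by (rule inv_limit_extend[where F = F, OF assms(3)])
      then obtain x where x: "x \<in> topspace X" "(\<lambda>i. p i x) = case_nat (F 0 (z 0)) z" using im by (metis imageE)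
      have "(\<lambda>i. p (Suc i) x) = z" using fun_cong[OF x(2), of "Suc _"] by auto
      then show "z \<in> (\<lambda>x i. p (Suc i) x) ` topspace X" using x(1) by blast
    qed
    show "inj_on (\<lambda>x i. p (Suc i) x) (topspace X)"
    proof (rule inj_onI)
      fix x y assume xy: "x \<in> topspace X" "y \<in> topspace X" "(\<lambda>i. p (Suc i) x) = (\<lambda>i. p (Suc i) y)"
      then have "p (Suc i) x = p (Suc i) y" for i by metis
      then have "p i x = p i y" for i using p(2) xy(1,2) by metis
      then show "x = y" using expansion_separates[OF assms(1)] xy by blast
    qed
  qed
  then show ?thesis using assms(1) unfolding expansion_def by blast
qed

lemma expansion_shift:
  assumes "expansion X \<phi> x0 F p" "compact_space X" "\<And>i. F i ` W2 \<subseteq> W2"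
  shows "expansion X \<phi> x0 (\<lambda>i. F (k + i)) (\<lambda>i. p (k + i))"
proof (induction k)
  case (Suc k)
  then show ?case using expansion_Suc[OF Suc assms(2)] assms(3) by simp
qed (use assms(1) in simp)

lemma positive_map_for_wedge_map:
  assumes "positive_map_for \<theta> f" "\<And>c. \<theta> c \<noteq> [] \<and> hd (\<theta> c) = e"
  shows "wedge_map e f"
  using assms unfolding positive_map_for_def wedge_map_def by blast

text \<open>Both words of \<open>sigma_sub\<close> and both words of \<open>tau_sub\<close> start
  with \<open>GA\<close>, both words of \<open>rho_sub\<close> with \<open>GB\<close>.\<close>

lemma bond_wedge_map:
  assumes "positive_map_for sigma_sub fs" "positive_map_for tau_sub ft" "positive_map_for rho_sub fr"
  shows "\<exists>e. wedge_map e (bond fs ft fr a)"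
proof -
  have "wedge_map GA fs" by (rule positive_map_for_wedge_map[OF assms(1)]) (auto simp: sigma_sub_def split: gen.split)
  moreover have "wedge_map GA ft" by (rule positive_map_for_wedge_map[OF assms(2)]) (auto simp: tau_sub_def split: gen.split)
  moreover have "wedge_map GB fr" by (rule positive_map_for_wedge_map[OF assms(3)]) (auto simp: rho_sub_def split: gen.split)
  ultimately show ?thesis by (cases a) (auto simp: bond_def)
qed

text \<open>Dropping \<open>k\<close> terms on one side and \<open>l\<close> on the other leaves
  expansions of the same two spaces with equal bonding maps.\<close>

lemma flow_equivalent_if_tail_equiv:
  assumes "positive_map_for sigma_sub fs" "positive_map_for tau_sub ft" "positive_map_for rho_sub fr"
    and "flow_space X \<phi>" "flow_space Y \<psi>"
    and "has_expansion_seq X \<phi> fs ft fr s" "has_expansion_seq Y \<psi> fs ft fr t" "tail_equiv s t"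
  shows "flow_equivalent X \<phi> Y \<psi>"
proof -
  obtain k l where kl: "\<And>j. s (k + j) = t (l + j)" using assms(8) unfolding tail_equiv_def by blast
  note wm = bond_wedge_map[OF assms(1-3)]
  have im: "bond fs ft fr a ` W2 \<subseteq> W2" for a using wm[of a] by (auto simp: wedge_map_def)
  have c: "compact_space X" "compact_space Y" using assms(4,5) by (auto simp: flow_space_def)
  obtain x0 p where p: "expansion X \<phi> x0 (\<lambda>i. bond fs ft fr (s i)) p"
    using assms(6) unfolding has_expansion_seq_def by blast
  obtain y0 q where q: "expansion Y \<psi> y0 (\<lambda>i. bond fs ft fr (t i)) q"
    using assms(7) unfolding has_expansion_seq_def by blast
  have "expansion X \<phi> x0 (\<lambda>i. bond fs ft fr (t (l + i))) (\<lambda>i. p (k + i))"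
    using expansion_shift[OF p c(1) im, of k] kl by simp
  then show ?thesis
    using flow_equivalent_if_same_bonds[OF wm assms(4) _ assms(5) expansion_shift[OF q c(2) im]] by blast
qed


section \<open>Carrying an expansion along a flow equivalence\<close>

text \<open>Time reversal turns statements about the right side of a time into statements about its
  left side.\<close>

lemma is_flow_reverse:
  assumes "is_flow X \<phi>"
  shows "is_flow X (\<lambda>t. \<phi> (- t))"
proof -
  have "continuous_map (prod_topology euclideanreal X) (prod_topology euclideanreal X) (\<lambda>z. (- fst z, snd z))"
    by (intro continuous_map_pairedI continuous_map_snd continuous_map_minus continuous_map_fst)
  then have "continuous_map (prod_topology euclideanreal X) X ((\<lambda>(t, x). \<phi> t x) \<circ> (\<lambda>z. (- fst z, snd z)))"
    using assms unfolding is_flow_def by (intro continuous_map_compose) auto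
  then have "continuous_map (prod_topology euclideanreal X) X (\<lambda>(t, x). \<phi> (- t) x)"
    by (simp add: o_def case_prod_unfold)
  moreover have "\<phi> (- (s + t)) x = \<phi> (- s) (\<phi> (- t) x)" if "x \<in> topspace X" for s t x
    using flow_add[OF assms that, of "- s" "- t"] by simp
  ultimately show ?thesis using flow_zero[OF assms] unfolding is_flow_def by auto
qed

text \<open>If the orbit is periodic, a strictly increasing time change may still jump by multiples of
  the period. Such a jump at time 0 is subtracted; the absence of short periods then rules out
  further jumps nearby.\<close>

lemma time_change_continuous_right:
  fixes \<tau> :: "real \<Rightarrow> real"
  assumes fl: "is_flow X \<phi>" "is_flow Y \<psi>" and "Hausdorff_space Y" "continuous_map X Y h"
    and x: "x \<in> topspace X" and \<tau>: "strict_mono \<tau>" "\<tau> 0 = 0" "\<And>t. h (\<phi> t x) = \<psi> (\<tau> t) (h x)"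
    and P: "0 < P" "\<And>u. 0 < u \<Longrightarrow> u < P \<Longrightarrow> \<psi> u (h x) \<noteq> h x"
  shows "\<exists>\<eta>>0. \<exists>\<tau>'. continuous_on {0..\<eta>} \<tau>' \<and> strict_mono_on {0..\<eta>} \<tau>' \<and> \<tau>' 0 = 0 \<and>
           (\<forall>t\<in>{0..\<eta>}. h (\<phi> t x) = \<psi> (\<tau>' t) (h x))"
proof -
  have y: "h x \<in> topspace Y" using assms(4) x by (auto simp: continuous_map_def)
  \<comment> \<open>The pairs of times at which the two orbits correspond. This closed set contains
    the graph of \<open>\<tau>\<close>, and continuity of the corrected time change will be read off
    from it.\<close>
  define C where "C = {z. h (\<phi> (fst z) x) = \<psi> (snd z) (h x)}"
  have "closed C"
  proof -
    have "continuous_map euclideanreal Y (h \<circ> (\<lambda>t. \<phi> t x))"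
      by (rule continuous_map_compose[OF flow_continuous_orbit[OF fl(1) x] assms(4)])
    then have "continuous_map (prod_topology euclideanreal euclideanreal) Y ((h \<circ> (\<lambda>t. \<phi> t x)) \<circ> fst)"
      by (rule continuous_map_compose[OF continuous_map_fst])
    moreover have "continuous_map (prod_topology euclideanreal euclideanreal) Y ((\<lambda>u. \<psi> u (h x)) \<circ> snd)"
      by (rule continuous_map_compose[OF continuous_map_snd flow_continuous_orbit[OF fl(2) y]])
    ultimately have "closedin (prod_topology euclideanreal euclideanreal)
        {z \<in> topspace (prod_topology euclideanreal euclideanreal).
           ((h \<circ> (\<lambda>t. \<phi> t x)) \<circ> fst) z = ((\<lambda>u. \<psi> u (h x)) \<circ> snd) z}"
      using assms(3) by (intro closedin_continuous_maps_eq)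
    then show ?thesis by (simp add: C_def o_def)
  qed
  have bd: "bdd_below (\<tau> ` {0<..})"
  proof (rule bdd_belowI2)
    show "0 \<le> \<tau> t" if "t \<in> {0<..}" for t
      using \<tau>(2) strict_mono_less_eq[OF \<tau>(1), of 0 t] that by simp
  qed
  \<comment> \<open>The right limit of \<open>\<tau>\<close> at 0. It may be positive, but
    closedness of \<open>C\<close> makes it a time at which the flow returns to
    \<open>h x\<close>.\<close>
  define L where "L = Inf (\<tau> ` {0<..})"
  have L_le: "L \<le> \<tau> t" if "0 < t" for t unfolding L_def using bd that by (intro cInf_lower) auto
  have L_less: "L < \<tau> t" if "0 < t" for t
    using L_le[of "t/2"] strict_monoD[OF \<tau>(1), of "t/2" t] that by simp
  have near: "\<exists>t>0. \<tau> t < a" if "L < a" for a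
    using cInf_lessD[of "\<tau> ` {0<..}" a] that unfolding L_def by auto
  have "(\<tau> \<longlongrightarrow> L) (at_right 0)"
  proof (rule order_tendstoI)
    fix a assume "a < L"
    then show "\<forall>\<^sub>F t in at_right 0. a < \<tau> t"
      using L_le unfolding eventually_at_right_field by (intro exI[of _ 1]) (auto intro: less_le_trans)
  next
    fix a assume "L < a"
    then obtain t where "t > 0" "\<tau> t < a" using near by blast
    then show "\<forall>\<^sub>F t in at_right 0. \<tau> t < a"
      using strict_monoD[OF \<tau>(1)] unfolding eventually_at_right_field by (intro exI[of _ t]) (auto intro: less_trans)
  qed
  then have "((\<lambda>t. (t, \<tau> t)) \<longlongrightarrow> (0, L)) (at_right 0)" by (intro tendsto_intros)
  moreover have "\<forall>\<^sub>F t in at_right (0::real). (t, \<tau> t) \<in> C" using \<tau>(3) by (simp add: C_def)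
  ultimately have "(0, L) \<in> C" using Lim_in_closed_set[OF \<open>closed C\<close>] by fastforce
  then have Ly: "\<psi> L (h x) = h x" using flow_zero[OF fl(1) x] by (simp add: C_def)
  define \<tau>' where "\<tau>' t = (if t \<le> 0 then 0 else \<tau> t - L)" for t
  \<comment> \<open>Values in an interval of length \<open>P / 2\<close> differ by less than
    \<open>P\<close>, so no two distinct ones give the same point of the orbit.\<close>
  obtain \<eta> where \<eta>: "\<eta> > 0" "\<tau> \<eta> < L + P / 2" using near[of "L + P / 2"] P(1) by auto
  have sm: "\<tau>' s < \<tau>' t" if "0 \<le> s" "s < t" for s t
    using that L_less[of t] strict_monoD[OF \<tau>(1), of s t] by (auto simp: \<tau>'_def)
  have rng: "\<tau>' t \<in> {0..P/2}" if "t \<in> {0..\<eta>}" for t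
    using that \<eta> L_less[of t] strict_mono_less_eq[OF \<tau>(1), of t \<eta>] P(1) by (auto simp: \<tau>'_def)
  have eq: "h (\<phi> t x) = \<psi> (\<tau>' t) (h x)" if "0 \<le> t" for t
  proof (cases "t = 0")
    case True
    then show ?thesis using flow_zero[OF fl(1) x] flow_zero[OF fl(2) y] by (simp add: \<tau>'_def)
  next
    case False
    have "\<psi> (\<tau>' t) (h x) = \<psi> (\<tau>' t) (\<psi> L (h x))" using Ly by simp
    also have "\<dots> = \<psi> (\<tau> t) (h x)" using flow_add[OF fl(2) y] False that by (simp add: \<tau>'_def)
    finally show ?thesis using \<tau>(3) by simp
  qed
  have uniq: "u = v" if uv: "\<psi> u (h x) = \<psi> v (h x)" "u \<in> {0..P/2}" "v \<in> {0..P/2}" for u v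
  proof -
    have period: "\<psi> (b - a) (h x) = h x" if "\<psi> a (h x) = \<psi> b (h x)" for a b
      using flow_add[OF fl(2) y, of "- a" b] flow_add[OF fl(2) y, of "- a" a] that flow_zero[OF fl(2) y] by simp
    show ?thesis
      using period[OF uv(1)] period[OF uv(1)[symmetric]] uv(2,3) P(1) P(2)[of "v - u"] P(2)[of "u - v"]
      by (cases u v rule: linorder_cases) auto
  qed
  \<comment> \<open>By \<open>uniq\<close> the graph is the whole part of \<open>C\<close> in a
    compact box, hence closed; a closed graph with values in a compact set gives continuity.\<close>
  have "(\<lambda>t. (t, \<tau>' t)) ` {0..\<eta>} = C \<inter> {0..\<eta>} \<times> {0..P/2}"
  proof (intro equalityI subsetI)
    fix z assume "z \<in> (\<lambda>t. (t, \<tau>' t)) ` {0..\<eta>}"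
    then show "z \<in> C \<inter> {0..\<eta>} \<times> {0..P/2}" using rng eq by (auto simp: C_def)
  next
    fix z assume z: "z \<in> C \<inter> {0..\<eta>} \<times> {0..P/2}"
    then have "snd z = \<tau>' (fst z)" using eq[of "fst z"] rng[of "fst z"] by (intro uniq) (auto simp: C_def)
    then show "z \<in> (\<lambda>t. (t, \<tau>' t)) ` {0..\<eta>}" using z by (intro image_eqI[of _ _ "fst z"]) (auto simp: prod_eq_iff)
  qed
  then have "closed ((\<lambda>t. (t, \<tau>' t)) ` {0..\<eta>})"
    using \<open>closed C\<close> by (simp add: closed_Int closed_Times)
  then have "continuous_on {0..\<eta>} \<tau>'"
    using rng by (intro continuous_from_closed_graph[of "{0..P/2}"]) auto
  moreover have "strict_mono_on {0..\<eta>} \<tau>'" using sm by (auto intro: strict_mono_onI)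
  moreover have "\<tau>' 0 = 0" by (simp add: \<tau>'_def)
  ultimately show ?thesis using \<eta>(1) eq by (intro exI[of _ \<eta>] conjI exI[of _ \<tau>']) auto
qed

lemma strict_mono_on_interval_inverse:
  fixes f :: "real \<Rightarrow> real"
  assumes "0 < \<eta>" "continuous_on {0..\<eta>} f" "strict_mono_on {0..\<eta>} f" "f 0 = 0"
  obtains \<delta> \<sigma> where "0 < \<delta>" "continuous_on {0..\<delta>} \<sigma>" "strict_mono_on {0..\<delta>} \<sigma>" "\<sigma> 0 = 0"
    "\<And>u. u \<in> {0..\<delta>} \<Longrightarrow> \<sigma> u \<in> {0..\<eta>} \<and> f (\<sigma> u) = u"
proof -
  have inj: "inj_on f {0..\<eta>}" using assms(3) by (rule strict_mono_on_imp_inj_on)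
  define \<sigma> where "\<sigma> = inv_into {0..\<eta>} f"
  have mono: "f s \<le> f t" if "s \<in> {0..\<eta>}" "t \<in> {0..\<eta>}" "s \<le> t" for s t
    using strict_mono_onD[OF assms(3), of s t] that by (cases "s = t") auto
  have pos: "0 < f \<eta>" using strict_mono_onD[OF assms(3), of 0 \<eta>] assms(1,4) by simp
  have im: "f ` {0..\<eta>} = {0..f \<eta>}"
  proof (intro equalityI subsetI)
    fix u assume "u \<in> {0..f \<eta>}"
    then show "u \<in> f ` {0..\<eta>}" using IVT'[of f 0 u \<eta>] assms by auto
  next
    fix u assume "u \<in> f ` {0..\<eta>}"
    then show "u \<in> {0..f \<eta>}" using mono[of 0] mono[of _ \<eta>] assms(1,4) by auto
  qed
  have \<sigma>: "\<sigma> u \<in> {0..\<eta>} \<and> f (\<sigma> u) = u" if "u \<in> {0..f \<eta>}" for u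
    using that im unfolding \<sigma>_def by (metis f_inv_into_f inv_into_into)
  have "continuous_on {0..f \<eta>} \<sigma>"
    using continuous_on_inv[OF assms(2), of \<sigma>] inj im by (simp add: \<sigma>_def)
  moreover have "strict_mono_on {0..f \<eta>} \<sigma>"
  proof (rule strict_mono_onI)
    fix u v assume uv: "u \<in> {0..f \<eta>}" "v \<in> {0..f \<eta>}" "u < v"
    then show "\<sigma> u < \<sigma> v" using mono[of "\<sigma> v" "\<sigma> u"] \<sigma>[of u] \<sigma>[of v] by (cases "\<sigma> u < \<sigma> v") auto
  qed
  moreover have "\<sigma> 0 = 0" using inv_into_f_f[OF inj, of 0] assms(1,4) by (simp add: \<sigma>_def)
  ultimately show ?thesis using that pos \<sigma> by blast
qed

text \<open>Pulling paths in \<open>Y\<close> back to \<open>X\<close> needs the time of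
  \<open>X\<close> as a function of the time of \<open>Y\<close>. The bound
  \<open>\<epsilon>\<close> keeps the result inside the domain of a given germ in
  \<open>X\<close>.\<close>

lemma time_change_inverse_right:
  fixes \<tau> :: "real \<Rightarrow> real"
  assumes "is_flow X \<phi>" "is_flow Y \<psi>" "Hausdorff_space Y" "continuous_map X Y h"
    and "x \<in> topspace X" "strict_mono \<tau>" "\<tau> 0 = 0" "\<And>t. h (\<phi> t x) = \<psi> (\<tau> t) (h x)"
    and "0 < P" "\<And>u. 0 < u \<Longrightarrow> u < P \<Longrightarrow> \<psi> u (h x) \<noteq> h x" and "0 < \<epsilon>"
  obtains \<delta> \<sigma> where "0 < \<delta>" "continuous_on {0..\<delta>} \<sigma>" "strict_mono_on {0..\<delta>} \<sigma>" "\<sigma> 0 = 0"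
    "\<And>u. u \<in> {0..\<delta>} \<Longrightarrow> \<sigma> u \<in> {0..\<epsilon>} \<and> \<psi> u (h x) = h (\<phi> (\<sigma> u) x)"
proof -
  obtain \<eta> \<tau>' where \<eta>: "\<eta> > 0" "continuous_on {0..\<eta>} \<tau>'" "strict_mono_on {0..\<eta>} \<tau>'" "\<tau>' 0 = 0"
      "\<forall>t\<in>{0..\<eta>}. h (\<phi> t x) = \<psi> (\<tau>' t) (h x)"
    using time_change_continuous_right[OF assms(1-10)] by blast
  define m where "m = min \<eta> \<epsilon>"
  have m: "0 < m" "{0..m} \<subseteq> {0..\<eta>}" "{0..m} \<subseteq> {0..\<epsilon>}" using \<eta>(1) assms(11) by (auto simp: m_def)
  obtain \<delta> \<sigma> where d: "0 < \<delta>" "continuous_on {0..\<delta>} \<sigma>" "strict_mono_on {0..\<delta>} \<sigma>" "\<sigma> 0 = 0"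
    "\<And>u. u \<in> {0..\<delta>} \<Longrightarrow> \<sigma> u \<in> {0..m} \<and> \<tau>' (\<sigma> u) = u"
    using strict_mono_on_interval_inverse[OF m(1) continuous_on_subset[OF \<eta>(2) m(2)]
        monotone_on_subset[OF \<eta>(3) m(2)] \<eta>(4)] by blast
  have "\<sigma> u \<in> {0..\<epsilon>} \<and> \<psi> u (h x) = h (\<phi> (\<sigma> u) x)" if "u \<in> {0..\<delta>}" for u
  proof -
    have "\<sigma> u \<in> {0..m}" "\<tau>' (\<sigma> u) = u" using d(5)[OF that] by auto
    then show ?thesis using \<eta>(5) m(2,3) by (metis subsetD)
  qed
  then show ?thesis using that d by blast
qed

text \<open>On its first stretch a positive path advances its parameter by less than 1. A return
  within that stretch would make the advance an integer strictly between 0 and 1.\<close>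

lemma no_short_periods:
  assumes "expansion Y \<psi> y0 F q" "is_flow Y \<psi>" "y \<in> topspace Y"
  obtains P where "0 < P" "\<And>u. 0 < u \<Longrightarrow> u < P \<Longrightarrow> \<psi> u y \<noteq> y"
proof -
  have "positive_path (\<lambda>t. q 0 (\<psi> t y))" using assms unfolding expansion_def by blast
  then obtain \<epsilon> c \<alpha> where e: "\<epsilon> > 0" "strict_mono_on {0..0+\<epsilon>} \<alpha>" "\<alpha> (0+\<epsilon>) - \<alpha> 0 < 1"
     "\<forall>t\<in>{0..0+\<epsilon>}. q 0 (\<psi> t y) = gam c (\<alpha> t)"
    unfolding positive_path_def by meson
  have "\<psi> u y \<noteq> y" if u: "0 < u" "u < \<epsilon>" for u
  proof
    assume "\<psi> u y = y"
    then have "gam c (\<alpha> u) = gam c (\<alpha> 0)" using e(1,4) u flow_zero[OF assms(2,3)]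
      by (metis add_0 atLeastAtMost_iff less_eq_real_def)
    then have "\<alpha> u - \<alpha> 0 \<in> \<int>" by (rule gam_eq_imp_Ints)
    then obtain n :: int where n: "\<alpha> u - \<alpha> 0 = of_int n" by (auto elim: Ints_cases)
    have "\<alpha> 0 < \<alpha> u" "\<alpha> u < \<alpha> \<epsilon>" using strict_mono_onD[OF e(2)] u by auto
    then have "0 < real_of_int n" "real_of_int n < 1" using e(3) unfolding n[symmetric] by auto
    then show False by simp
  qed
  then show ?thesis using that e(1) by blast
qed

text \<open>With the base time moved to 0 at the point \<open>k (\<psi> t0 y)\<close>, the
  parameters of the path in \<open>X\<close> are composed with local inverses of the time change.
  These are continuous, whereas \<open>\<tau>\<close> itself may jump.\<close>

lemma positive_path_transport:
  assumes fl: "is_flow X \<phi>" "is_flow Y \<psi>" and "Hausdorff_space Y" and hk: "homeomorphic_maps X Y h k"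
    and \<tau>: "\<And>x. x \<in> topspace X \<Longrightarrow> \<exists>\<tau> :: real \<Rightarrow> real. strict_mono \<tau> \<and> \<tau> 0 = 0 \<and> (\<forall>t. h (\<phi> t x) = \<psi> (\<tau> t) (h x))"
    and P: "\<And>y. y \<in> topspace Y \<Longrightarrow> \<exists>P>0. \<forall>u. 0 < u \<and> u < P \<longrightarrow> \<psi> u y \<noteq> y"
    and p: "\<And>x. x \<in> topspace X \<Longrightarrow> positive_path (\<lambda>t. p (\<phi> t x))"
    and y: "y \<in> topspace Y"
  shows "positive_path (\<lambda>t. p (k (\<psi> t y)))"
  unfolding positive_path_def
proof
  fix t0
  define y0 where "y0 = \<psi> t0 y"
  define x where "x = k y0"
  have y0: "y0 \<in> topspace Y" using flow_in_topspace[OF fl(2) y] by (simp add: y0_def)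
  then have x: "x \<in> topspace X" "h x = y0"
    using hk unfolding x_def by (auto simp: homeomorphic_maps_def continuous_map_def)
  have h: "continuous_map X Y h" using hk by (simp add: homeomorphic_maps_def)
  have kh: "k (h z) = z" if "z \<in> topspace X" for z using hk that by (simp add: homeomorphic_maps_def)
  have kpath: "k (\<psi> t y) = \<phi> s x" if "\<psi> (t - t0) (h x) = h (\<phi> s x)" for s t
    using that kh[OF flow_in_topspace[OF fl(1) x(1)], of s] flow_add[OF fl(2) y, of "t - t0" t0] x(2)
    by (simp add: y0_def)
  obtain \<tau> :: "real \<Rightarrow> real" where t: "strict_mono \<tau>" "\<tau> 0 = 0" "\<And>t. h (\<phi> t x) = \<psi> (\<tau> t) (h x)"
    using \<tau>[OF x(1)] by blast
  obtain P where P: "0 < P" "\<And>u. 0 < u \<Longrightarrow> u < P \<Longrightarrow> \<psi> u (h x) \<noteq> h x"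
    using P[OF y0] x(2) by blast
  obtain \<epsilon> c \<alpha> d \<beta> where e: "\<epsilon> > 0" "continuous_on {0..0+\<epsilon>} \<alpha>" "strict_mono_on {0..0+\<epsilon>} \<alpha>" "\<alpha> (0+\<epsilon>) - \<alpha> 0 < 1"
     "\<forall>t\<in>{0..0+\<epsilon>}. p (\<phi> t x) = gam c (\<alpha> t)"
     and b: "continuous_on {0-\<epsilon>..0} \<beta>" "strict_mono_on {0-\<epsilon>..0} \<beta>" "\<beta> 0 - \<beta> (0-\<epsilon>) < 1"
     "\<forall>t\<in>{0-\<epsilon>..0}. p (\<phi> t x) = gam d (\<beta> t)"
    using p[OF x(1)] unfolding positive_path_def by meson
  obtain \<delta> \<sigma> where s: "0 < \<delta>" "continuous_on {0..\<delta>} \<sigma>" "strict_mono_on {0..\<delta>} \<sigma>" "\<sigma> 0 = 0"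
    "\<And>u. u \<in> {0..\<delta>} \<Longrightarrow> \<sigma> u \<in> {0..\<epsilon>} \<and> \<psi> u (h x) = h (\<phi> (\<sigma> u) x)"
    using time_change_inverse_right[OF fl assms(3) h x(1) t P e(1)] by blast
  \<comment> \<open>The left side is the right side of the reversed flows.\<close>
  have "strict_mono (\<lambda>t. - \<tau> (- t))" using t(1) by (auto simp: strict_mono_def)
  moreover have "\<psi> (- u) (h x) \<noteq> h x" if "0 < u" "u < P" for u
    using P(2)[OF that] flow_add[OF fl(2) y0, of u "- u"] flow_zero[OF fl(2) y0] x(2) by auto
  ultimately obtain \<delta>' \<sigma>' where s': "0 < \<delta>'" "continuous_on {0..\<delta>'} \<sigma>'" "strict_mono_on {0..\<delta>'} \<sigma>'" "\<sigma>' 0 = 0"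
    "\<And>u. u \<in> {0..\<delta>'} \<Longrightarrow> \<sigma>' u \<in> {0..\<epsilon>} \<and> \<psi> (- u) (h x) = h (\<phi> (- \<sigma>' u) x)"
    using time_change_inverse_right[OF is_flow_reverse[OF fl(1)] is_flow_reverse[OF fl(2)] assms(3) h x(1),
        of "\<lambda>t. - \<tau> (- t)" P \<epsilon>] t P(1) e(1) by auto
  \<comment> \<open>\<open>positive_path\<close> asks for one radius that serves both sides.\<close>
  define r where "r = min \<delta> \<delta>'"
  have r: "r > 0" "r \<le> \<delta>" "r \<le> \<delta>'" using s(1) s'(1) by (auto simp: r_def)
  have right: "continuous_on {t0..t0+r} (\<lambda>t. \<alpha> (\<sigma> (t - t0)))" "strict_mono_on {t0..t0+r} (\<lambda>t. \<alpha> (\<sigma> (t - t0)))"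
    "\<alpha> (\<sigma> (t0 + r - t0)) - \<alpha> (\<sigma> (t0 - t0)) < 1" "\<forall>t\<in>{t0..t0+r}. p (k (\<psi> t y)) = gam c (\<alpha> (\<sigma> (t - t0)))"
  proof -
    have "continuous_on {t0..t0+r} (\<lambda>t. \<sigma> (t - t0))"
      by (rule continuous_on_compose2[OF s(2)]) (use r in \<open>auto intro!: continuous_intros\<close>)
    then show "continuous_on {t0..t0+r} (\<lambda>t. \<alpha> (\<sigma> (t - t0)))"
      using s(5) r by (intro continuous_on_compose2[OF e(2)]) auto
    show "strict_mono_on {t0..t0+r} (\<lambda>t. \<alpha> (\<sigma> (t - t0)))"
      using s(5) r by (intro strict_mono_onI strict_mono_onD[OF e(3)] strict_mono_onD[OF s(3)]) auto
    \<comment> \<open>\<open>\<sigma> r\<close> does not exceed \<open>\<epsilon>\<close>, so the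
      bound 1 on the advance of \<open>\<alpha>\<close> is inherited.\<close>
    have "\<alpha> (\<sigma> r) \<le> \<alpha> \<epsilon>"
      using s(5)[of r] r strict_mono_onD[OF e(3), of "\<sigma> r" \<epsilon>] e(1) by (cases "\<sigma> r = \<epsilon>") auto
    then show "\<alpha> (\<sigma> (t0 + r - t0)) - \<alpha> (\<sigma> (t0 - t0)) < 1" using e(4) s(4) by simp
    show "\<forall>t\<in>{t0..t0+r}. p (k (\<psi> t y)) = gam c (\<alpha> (\<sigma> (t - t0)))"
    proof
      fix t assume "t \<in> {t0..t0+r}"
      then have "t - t0 \<in> {0..\<delta>}" using r by auto
      then show "p (k (\<psi> t y)) = gam c (\<alpha> (\<sigma> (t - t0)))"
        using s(5)[of "t - t0"] kpath[of t "\<sigma> (t - t0)"] e(5) by simp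
    qed
  qed
  have left: "continuous_on {t0-r..t0} (\<lambda>t. \<beta> (- \<sigma>' (t0 - t)))" "strict_mono_on {t0-r..t0} (\<lambda>t. \<beta> (- \<sigma>' (t0 - t)))"
    "\<beta> (- \<sigma>' (t0 - t0)) - \<beta> (- \<sigma>' (t0 - (t0 - r))) < 1" "\<forall>t\<in>{t0-r..t0}. p (k (\<psi> t y)) = gam d (\<beta> (- \<sigma>' (t0 - t)))"
  proof -
    have "continuous_on {t0-r..t0} (\<lambda>t. \<sigma>' (t0 - t))"
      by (rule continuous_on_compose2[OF s'(2)]) (use r in \<open>auto intro!: continuous_intros\<close>)
    then have "continuous_on {t0-r..t0} (\<lambda>t. - \<sigma>' (t0 - t))" by (rule continuous_on_minus)
    then show "continuous_on {t0-r..t0} (\<lambda>t. \<beta> (- \<sigma>' (t0 - t)))"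
      using s'(5) r by (intro continuous_on_compose2[OF b(1)]) auto
    show "strict_mono_on {t0-r..t0} (\<lambda>t. \<beta> (- \<sigma>' (t0 - t)))"
    proof (rule strict_mono_onI)
      fix u v assume "u \<in> {t0-r..t0}" "v \<in> {t0-r..t0}" "u < v"
      then have "\<sigma>' (t0 - v) < \<sigma>' (t0 - u)" "\<sigma>' (t0 - v) \<in> {0..\<epsilon>}" "\<sigma>' (t0 - u) \<in> {0..\<epsilon>}"
        using strict_mono_onD[OF s'(3), of "t0 - v" "t0 - u"] s'(5)[of "t0 - v"] s'(5)[of "t0 - u"] r by auto
      then show "\<beta> (- \<sigma>' (t0 - u)) < \<beta> (- \<sigma>' (t0 - v))" by (intro strict_mono_onD[OF b(2)]) auto
    qed
    have "\<beta> (- \<epsilon>) \<le> \<beta> (- \<sigma>' r)"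
      using s'(5)[of r] r strict_mono_onD[OF b(2), of "- \<epsilon>" "- \<sigma>' r"] e(1) by (cases "\<sigma>' r = \<epsilon>") auto
    then show "\<beta> (- \<sigma>' (t0 - t0)) - \<beta> (- \<sigma>' (t0 - (t0 - r))) < 1" using b(3) s'(4) by simp
    show "\<forall>t\<in>{t0-r..t0}. p (k (\<psi> t y)) = gam d (\<beta> (- \<sigma>' (t0 - t)))"
    proof
      fix t assume "t \<in> {t0-r..t0}"
      then have "t0 - t \<in> {0..\<delta>'}" using r by auto
      then show "p (k (\<psi> t y)) = gam d (\<beta> (- \<sigma>' (t0 - t)))"
        using s'(5)[of "t0 - t"] kpath[of t "- \<sigma>' (t0 - t)"] b(4) by simp
    qed
  qed
  show "\<exists>\<epsilon>>0.
        (\<exists>c \<alpha>. continuous_on {t0 .. t0 + \<epsilon>} \<alpha> \<and> strict_mono_on {t0 .. t0 + \<epsilon>} \<alpha> \<and>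
               \<alpha> (t0 + \<epsilon>) - \<alpha> t0 < 1 \<and> (\<forall>t \<in> {t0 .. t0 + \<epsilon>}. p (k (\<psi> t y)) = gam c (\<alpha> t))) \<and>
        (\<exists>c \<alpha>. continuous_on {t0 - \<epsilon> .. t0} \<alpha> \<and> strict_mono_on {t0 - \<epsilon> .. t0} \<alpha> \<and>
               \<alpha> t0 - \<alpha> (t0 - \<epsilon>) < 1 \<and> (\<forall>t \<in> {t0 - \<epsilon> .. t0}. p (k (\<psi> t y)) = gam c (\<alpha> t)))"
    using r(1) right left
    by (intro exI[of _ r] conjI exI[of _ c] exI[of _ d] exI[of _ "\<lambda>t. \<alpha> (\<sigma> (t - t0))"]
        exI[of _ "\<lambda>t. \<beta> (- \<sigma>' (t0 - t))"])
qed

text \<open>The projections of \<open>X\<close> are composed with the inverse homeomorphism.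
  Topological conditions pass over directly; positivity along orbits needs
  \<open>positive_path_transport\<close>, for which the expansion \<open>q\<close> excludes short
  periods in \<open>Y\<close>.\<close>

lemma expansion_transport:
  assumes X: "flow_space X \<phi>" "expansion X \<phi> x0 F p" and Y: "flow_space Y \<psi>" "expansion Y \<psi> y0 F' q"
    and "flow_equivalent X \<phi> Y \<psi>"
  shows "\<exists>z0 r. expansion Y \<psi> z0 F r"
proof -
  have fl: "is_flow X \<phi>" "is_flow Y \<psi>" using X Y by (auto simp: flow_space_def)
  have haus: "Hausdorff_space Y" using Y(1) metrizable_imp_Hausdorff_space by (auto simp: flow_space_def)
  obtain h where h: "homeomorphic_map X Y h"
      "\<And>x. x \<in> topspace X \<Longrightarrow> \<exists>\<tau> :: real \<Rightarrow> real. strict_mono \<tau> \<and> \<tau> 0 = 0 \<and> (\<forall>t. h (\<phi> t x) = \<psi> (\<tau> t) (h x))"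
    using assms(5) unfolding flow_equivalent_def by blast
  obtain k where hk: "homeomorphic_maps X Y h k" using h(1) homeomorphic_map_maps by blast
  have P: "\<exists>P>0. \<forall>u. 0 < u \<and> u < P \<longrightarrow> \<psi> u y \<noteq> y" if "y \<in> topspace Y" for y
    using no_short_periods[OF Y(2) fl(2) that] by metis
  have hm: "homeomorphic_map Y X k" using hk homeomorphic_maps_map by metis
  then have k: "continuous_map Y X k" "k ` topspace Y = topspace X" "homeomorphic_map Y X k"
    using homeomorphic_imp_continuous_map homeomorphic_imp_surjective_map by blast+
  have p: "continuous_map X (top_of_set W2) (p i)" "p i ` topspace X = W2" "p i x0 = wedge_pt"
      "\<And>x. x \<in> topspace X \<Longrightarrow> positive_path (\<lambda>t. p i (\<phi> t x))" 
      "\<And>x. x \<in> topspace X \<Longrightarrow> p i x = F i (p (Suc i) x)" for i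
    using X(2) unfolding expansion_def by blast+
  have p': "homeomorphic_map X (inv_limit_top F) (\<lambda>x i. p i x)" "x0 \<in> topspace X"
    using X(2) unfolding expansion_def by blast+
  have "expansion Y \<psi> (h x0) F (\<lambda>i y. p i (k y))"
    unfolding expansion_def
  proof (intro conjI allI ballI)
    fix i
    show "h x0 \<in> topspace Y" using hk p'(2) by (auto simp: homeomorphic_maps_def continuous_map_def)
    show "continuous_map Y (top_of_set W2) (\<lambda>y. p i (k y))"
      using continuous_map_compose[OF k(1) p(1)] by (simp add: o_def)
    show "(\<lambda>y. p i (k y)) ` topspace Y = W2" using p(2) k(2) by (metis image_image)
    show "p i (k (h x0)) = wedge_pt" using hk p(3) p'(2) by (simp add: homeomorphic_maps_def)
    show "positive_path (\<lambda>t. p i (k (\<psi> t y)))" if "y \<in> topspace Y" for y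
      by (rule positive_path_transport[OF fl haus hk h(2) P p(4) that])
    show "p i (k y) = F i (p (Suc i) (k y))" if "y \<in> topspace Y" for y
      using p(5) k(2) that by blast
    show "homeomorphic_map Y (inv_limit_top F) (\<lambda>y i. p i (k y))"
      using homeomorphic_map_compose[OF k(3) p'(1)] by (simp add: o_def)
  qed
  then show ?thesis by blast
qed

lemma has_expansion_seq_transport:
  assumes "flow_space X \<phi>" "flow_space Y \<psi>" "flow_equivalent X \<phi> Y \<psi>"
    and "has_expansion_seq X \<phi> fs ft fr s" "has_expansion_seq Y \<psi> fs ft fr t"
  shows "has_expansion_seq Y \<psi> fs ft fr s"
  using assms expansion_transport unfolding has_expansion_seq_def by metis

theorem theorem8p7:
  fixes X :: "'a topology" and \<phi> :: "real \<Rightarrow> 'a \<Rightarrow> 'a"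
    and Y :: "'b topology" and \<psi> :: "real \<Rightarrow> 'b \<Rightarrow> 'b"
    and f\<sigma> f\<tau> f\<rho> :: "complex \<Rightarrow> complex"
  assumes "positive_map_for sigma_sub f\<sigma>"
    and "positive_map_for tau_sub f\<tau>"
    and "positive_map_for rho_sub f\<rho>"
    and "in_Sigma X \<phi> f\<sigma> f\<tau> f\<rho> \<or> in_T X \<phi> f\<sigma> f\<tau> f\<rho>"
    and "in_Sigma Y \<psi> f\<sigma> f\<tau> f\<rho> \<or> in_T Y \<psi> f\<sigma> f\<tau> f\<rho>"
    and "non_constant X \<phi> f\<sigma> f\<tau> f\<rho>"
    and "non_constant Y \<psi> f\<sigma> f\<tau> f\<rho>"
  shows "flow_equivalent X \<phi> Y \<psi> \<longleftrightarrow>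
    (\<exists>s t. admissible_seq X \<phi> f\<sigma> f\<tau> f\<rho> s \<and> admissible_seq Y \<psi> f\<sigma> f\<tau> f\<rho> t \<and>
           tail_equiv s t)"
proof
  have fs: "flow_space X \<phi>" "flow_space Y \<psi>"
    using assms(4,5) by (auto simp: in_Sigma_def in_T_def)
  {
    assume fe: "flow_equivalent X \<phi> Y \<psi>"
    obtain s t where s: "admissible_seq X \<phi> f\<sigma> f\<tau> f\<rho> s" and t: "admissible_seq Y \<psi> f\<sigma> f\<tau> f\<rho> t"
      using assms(6,7) unfolding non_constant_def by blast
    \<comment> \<open>The condition on the symbols concerns \<open>s\<close> alone, while
      \<open>t\<close> supplies the expansion of \<open>Y\<close> that the transport asks
      for.\<close>
    then have "admissible_seq Y \<psi> f\<sigma> f\<tau> f\<rho> s"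
      using has_expansion_seq_transport[OF fs fe] unfolding admissible_seq_def by blast
    moreover have "tail_equiv s s" by (auto simp: tail_equiv_def)
    ultimately show "\<exists>s t. admissible_seq X \<phi> f\<sigma> f\<tau> f\<rho> s \<and> admissible_seq Y \<psi> f\<sigma> f\<tau> f\<rho> t \<and> tail_equiv s t"
      using s by blast
  next
    assume "\<exists>s t. admissible_seq X \<phi> f\<sigma> f\<tau> f\<rho> s \<and> admissible_seq Y \<psi> f\<sigma> f\<tau> f\<rho> t \<and> tail_equiv s t"
    then show "flow_equivalent X \<phi> Y \<psi>"
      using flow_equivalent_if_tail_equiv[OF assms(1-3) fs] unfolding admissible_seq_def by blast
  }
qed

end
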